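(* Let $X$ be a finite set. The linear map $\Lambda:\mathcal{T}_X^{\rm d}\to\mathcal{L}_X$, given by $\Lambda(\phi)=(\phi(e_{x,x',a,a'}))_{x,x',a,a'\in X}$, is a well-defined complete order isomorphism.
   Context: Definition of $\mathcal{T}_X$: a bi-isometry is a block operator matrix $V=(V_{a,x})_{a,x\in X}$, $V_{a,x}\in\mathcal{B}(H,K)$, with $\sum_aV_{a,x}^*V_{a,x'}=\delta_{x,x'}I$ and $\sum_xV_{a,x}^*V_{a',x}=\delta_{a,a'}I$. Let $(v_{a,x})$ be the universal bi-isometry (direct sum of representatives of all unitary equivalence classes of bi-isometries on Hilbert spaces of dimension bounded by a fixed sufficiently large infinite cardinal), let $\mathcal{C}_X$ be the unital C*-algebra generated by $e_{x,x',a,a'}:=v_{a,x}^*v_{a',x'}$, and $\mathcal{T}_X=\mathrm{span}\{e_{x,x',a,a'}:x,x',a,a'\in X\}$, an operator subsystem of $\mathcal{C}_X$. Dual operator system: for a finite dimensional operator system $\mathcal{S}$, $\mathcal{S}^{\rm d}$ is its dual space with matrix cones $M_n(\mathcal{S}^{\rm d})^+$ consisting of those $(\phi_{i,j})_{i,j}$ for which $u\mapsto(\phi_{i,j}(u))_{i,j}$, $\mathcal{S}\to M_n$, is completely positive. $M_X$ is the algebra of complex $X\times X$ matrices with matrix units $\epsilon_{x,x'}$; $M_{XX}=M_X\otimes M_X$, and $(\lambda_{x,x',a,a'})$ denotes $\sum\lambda_{x,x',a,a'}\epsilon_{x,x'}\otimes\epsilon_{a,a'}\in M_{XX}$. $\mathcal{L}_X\subseteq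 M_{XX}$ is the operator subsystem of all $(\lambda_{x,x',a,a'})$ for which there exists $c\in\mathbb{C}$ with $\sum_{b\in X}\lambda_{x,x',b,b}=\delta_{x,x'}c$ and $\sum_{y\in X}\lambda_{y,y,a,a'}=\delta_{a,a'}c$ for all $x,x',a,a'\in X$. *)

theory Defs
  imports "HOL-Analysis.Analysis" "HOL-Library.Function_Algebras"
begin

section \<open>Complex vector spaces\<close>

text \<open>
  Vectors, operators and functionals are all functions, added pointwise as in
  \<^theory>\<open>HOL-Library.Function_Algebras\<close>.
\<close>

class complex_vector = ab_group_add +
  fixes scaleC :: "complex \<Rightarrow> 'a \<Rightarrow> 'a"  (infixr \<open>*\<^sub>C\<close> 75)
  assumes scaleC_add_right: "c *\<^sub>C (x + y) = c *\<^sub>C x + c *\<^sub>C y"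
    and scaleC_add_left: "(c + d) *\<^sub>C x = c *\<^sub>C x + d *\<^sub>C x"
    and scaleC_scaleC: "c *\<^sub>C d *\<^sub>C x = (c * d) *\<^sub>C x"
    and scaleC_one: "1 *\<^sub>C x = x"

global_interpretation complex_vector:
  vector_space "scaleC :: complex \<Rightarrow> 'a \<Rightarrow> 'a::complex_vector"
  by unfold_locales (rule scaleC_add_right scaleC_add_left scaleC_scaleC scaleC_one)+

instantiation complex :: complex_vector
begin
definition scaleC_complex :: "complex \<Rightarrow> complex \<Rightarrow> complex"
  where [simp]: "scaleC_complex c x = c * x"
instance by standard (simp_all add: algebra_simps)
end

instantiation "fun" :: (type, complex_vector) complex_vector
begin
definition scaleC_fun :: "complex \<Rightarrow> ('a \<Rightarrow> 'b) \<Rightarrow> 'a \<Rightarrow> 'b"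
  where "scaleC_fun c f = (\<lambda>x. c *\<^sub>C f x)"
instance
  by standard (simp_all add: scaleC_fun_def fun_eq_iff scaleC_add_right scaleC_add_left
      scaleC_scaleC scaleC_one)
end

instantiation vec :: (complex_vector, finite) complex_vector
begin
definition scaleC_vec :: "complex \<Rightarrow> ('a, 'b) vec \<Rightarrow> ('a, 'b) vec"
  where "scaleC_vec c v = (\<chi> i. c *\<^sub>C v $ i)"
instance
  by standard (simp_all add: scaleC_vec_def vec_eq_iff scaleC_add_right scaleC_add_left
      scaleC_scaleC scaleC_one)
end

definition clinear_on :: "'u::complex_vector set \<Rightarrow> ('u \<Rightarrow> 'v::complex_vector) \<Rightarrow> bool"
  where "clinear_on S f \<longleftrightarrow>
    (\<forall>u\<in>S. \<forall>v\<in>S. f (u + v) = f u + f v) \<and> (\<forall>c. \<forall>u\<in>S. f (c *\<^sub>C u) = c *\<^sub>C f u)"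


section \<open>Hilbert spaces and bounded operators\<close>

text \<open>
  Every Hilbert space is unitarily equivalent to some \<open>\<ell>\<^sup>2(S)\<close>, the dimension
  being the cardinality of \<open>S\<close>. Its elements are represented as functions on a whole type that
  vanish off \<open>S\<close>. Inner products are linear in the second argument.
\<close>

definition l2 :: "'i set \<Rightarrow> ('i \<Rightarrow> complex) set"
  where "l2 S = {f. (\<forall>i. i \<notin> S \<longrightarrow> f i = 0) \<and> (\<lambda>i. (cmod (f i))\<^sup>2) summable_on UNIV}"

definition l2_inner :: "('i \<Rightarrow> complex) \<Rightarrow> ('i \<Rightarrow> complex) \<Rightarrow> complex"
  where "l2_inner f g = (\<Sum>\<^sub>\<infinity>i. cnj (f i) * g i)"

definition l2_norm :: "('i \<Rightarrow> complex) \<Rightarrow> real"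
  where "l2_norm f = sqrt (\<Sum>\<^sub>\<infinity>i. (cmod (f i))\<^sup>2)"

type_synonym ('i, 'j) oper = "('i \<Rightarrow> complex) \<Rightarrow> ('j \<Rightarrow> complex)"

text \<open>
  \<open>bop S T\<close> is \<open>B(\<ell>\<^sup>2(S), \<ell>\<^sup>2(T))\<close>. An operator is given the value \<open>0\<close> at functions outside its
  domain \<open>\<ell>\<^sup>2(S)\<close>, so that equality of operators is equality of functions.
\<close>

definition bop :: "'i set \<Rightarrow> 'j set \<Rightarrow> ('i, 'j) oper set"
  where "bop S T = {A. clinear_on (l2 S) A \<and> A ` l2 S \<subseteq> l2 T \<and>
    (\<exists>c. \<forall>f\<in>l2 S. l2_norm (A f) \<le> c * l2_norm f) \<and> (\<forall>f. f \<notin> l2 S \<longrightarrow> A f = 0)}"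

definition idop :: "'i set \<Rightarrow> ('i, 'i) oper"
  where "idop S = (\<lambda>f. if f \<in> l2 S then f else 0)"

definition adj :: "'i set \<Rightarrow> 'j set \<Rightarrow> ('i, 'j) oper \<Rightarrow> ('j, 'i) oper"
  where "adj S T A =
    (THE B. B \<in> bop T S \<and> (\<forall>f\<in>l2 S. \<forall>g\<in>l2 T. l2_inner (A f) g = l2_inner f (B g)))"

definition op_norm :: "'i set \<Rightarrow> ('i, 'j) oper \<Rightarrow> real"
  where "op_norm S A = (SUP f\<in>{f \<in> l2 S. l2_norm f \<le> 1}. l2_norm (A f))"

definition unitary_op :: "'i set \<Rightarrow> 'j set \<Rightarrow> ('i, 'j) oper \<Rightarrow> bool"
  where "unitary_op S T U \<longleftrightarrow>
    U \<in> bop S T \<and> adj S T U \<circ> U = idop S \<and> U \<circ> adj S T U = idop T"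

definition unital_cstar_subalgebra :: "'i set \<Rightarrow> ('i, 'i) oper set \<Rightarrow> bool"
  where "unital_cstar_subalgebra S \<A> \<longleftrightarrow>
    \<A> \<subseteq> bop S S \<and> idop S \<in> \<A> \<and> complex_vector.subspace \<A> \<and>
    (\<forall>A\<in>\<A>. \<forall>B\<in>\<A>. A \<circ> B \<in> \<A>) \<and> (\<forall>A\<in>\<A>. adj S S A \<in> \<A>) \<and>
    (\<forall>u. \<forall>A\<in>bop S S. (\<forall>n. u n \<in> \<A>) \<and> (\<lambda>n::nat. op_norm S (u n - A)) \<longlonglongrightarrow> 0 \<longrightarrow> A \<in> \<A>)"

definition cstar_generated :: "'i set \<Rightarrow> ('i, 'i) oper set \<Rightarrow> ('i, 'i) oper set"
  where "cstar_generated S E = \<Inter>{\<A>. unital_cstar_subalgebra S \<A> \<and> E \<subseteq> \<A>}"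


section \<open>Matrix ordered spaces\<close>

text \<open>
  \<open>mcone \<S> n\<close> is the cone \<open>M\<^sub>n(\<S>)\<^sup>+\<close>. An \<open>n \<times> n\<close> matrix is a function of two natural
  numbers, of which only the entries with indices below \<open>n\<close> are significant.
\<close>

record 'u matrix_ordered =
  vecs :: "'u set"
  mcone :: "nat \<Rightarrow> (nat \<Rightarrow> nat \<Rightarrow> 'u) set"

definition subsystem :: "'u matrix_ordered \<Rightarrow> 'u set \<Rightarrow> 'u matrix_ordered"
  where "subsystem \<S> T = \<lparr>vecs = T, mcone = (\<lambda>n. {u \<in> mcone \<S> n. \<forall>i<n. \<forall>j<n. u i j \<in> T})\<rparr>"

definition completely_positive ::
    "'u::complex_vector matrix_ordered \<Rightarrow> 'v::complex_vector matrix_ordered \<Rightarrow> ('u \<Rightarrow> 'v) \<Rightarrow> bool"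
  where "completely_positive \<S> \<T> f \<longleftrightarrow>
    clinear_on (vecs \<S>) f \<and> f ` vecs \<S> \<subseteq> vecs \<T> \<and>
    (\<forall>n. \<forall>u\<in>mcone \<S> n. (\<lambda>i j. f (u i j)) \<in> mcone \<T> n)"

definition complete_order_isomorphism ::
    "'u::complex_vector matrix_ordered \<Rightarrow> 'v::complex_vector matrix_ordered \<Rightarrow> ('u \<Rightarrow> 'v) \<Rightarrow> bool"
  where "complete_order_isomorphism \<S> \<T> f \<longleftrightarrow>
    bij_betw f (vecs \<S>) (vecs \<T>) \<and> completely_positive \<S> \<T> f \<and>
    completely_positive \<T> \<S> (inv_into (vecs \<S>) f)"

text \<open>\<open>B(H)\<close> for \<open>H = \<ell>\<^sup>2(S)\<close>; a matrix over it is positive as an operator on \<open>H\<^sup>n\<close>.\<close>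

definition B_system :: "'i set \<Rightarrow> ('i, 'i) oper matrix_ordered"
  where "B_system S = \<lparr>vecs = bop S S,
    mcone = (\<lambda>n. {u. (\<forall>i<n. \<forall>j<n. u i j \<in> bop S S) \<and>
      (\<forall>\<xi>. (\<forall>i<n. \<xi> i \<in> l2 S) \<longrightarrow>
        (\<Sum>i<n. \<Sum>j<n. l2_inner (\<xi> i) (u i j (\<xi> j))) \<in> \<real>\<^sub>\<ge>\<^sub>0)})\<rparr>"

text \<open>The matrix algebra \<open>M\<^sub>n\<close>; its elements are normalised to vanish at indices not below \<open>n\<close>.\<close>

definition M_system :: "nat \<Rightarrow> (nat \<Rightarrow> nat \<Rightarrow> complex) matrix_ordered"
  where "M_system n =
    (let M = {A. \<forall>p q. \<not> (p < n \<and> q < n) \<longrightarrow> A p q = 0}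
     in \<lparr>vecs = M,
         mcone = (\<lambda>m. {u. (\<forall>k<m. \<forall>l<m. u k l \<in> M) \<and>
           (\<forall>\<xi>. (\<Sum>k<m. \<Sum>l<m. \<Sum>p<n. \<Sum>q<n. cnj (\<xi> k p) * u k l p q * \<xi> l q) \<in> \<real>\<^sub>\<ge>\<^sub>0)})\<rparr>)"

text \<open>The algebra of complex matrices indexed by a finite type.\<close>

definition matrix_system :: "(complex ^ 'p ^ 'p) matrix_ordered"
  where "matrix_system = \<lparr>vecs = UNIV,
    mcone = (\<lambda>n. {u. \<forall>\<xi> :: nat \<Rightarrow> complex ^ 'p.
      (\<Sum>i<n. \<Sum>j<n. \<Sum>p\<in>UNIV. cnj (\<xi> i $ p) * (u i j *v \<xi> j) $ p) \<in> \<real>\<^sub>\<ge>\<^sub>0})\<rparr>"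

text \<open>
  The dual of a finite dimensional operator system, where all linear functionals are bounded.
  A functional is given the value \<open>0\<close> off the system.
\<close>

definition dual_vecs :: "'u::complex_vector matrix_ordered \<Rightarrow> ('u \<Rightarrow> complex) set"
  where "dual_vecs \<S> = {\<phi>. clinear_on (vecs \<S>) \<phi> \<and> (\<forall>u. u \<notin> vecs \<S> \<longrightarrow> \<phi> u = 0)}"

definition dual_system :: "'u::complex_vector matrix_ordered \<Rightarrow> ('u \<Rightarrow> complex) matrix_ordered"
  where "dual_system \<S> = \<lparr>vecs = dual_vecs \<S>,
    mcone = (\<lambda>n. {\<phi>. (\<forall>i<n. \<forall>j<n. \<phi> i j \<in> dual_vecs \<S>) \<and>
      completely_positive \<S> (M_system n) (\<lambda>u i j. if i < n \<and> j < n then \<phi> i j u else 0)})\<rparr>"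


section \<open>The universal bi-isometry\<close>

text \<open>
  A block operator matrix \<open>(V\<^sub>a\<^sub>,\<^sub>x)\<close> from \<open>\<ell>\<^sup>2(dom_ix V)\<close> to \<open>\<ell>\<^sup>2(cod_ix V)\<close>. With index sets ranging
  over the subsets of an infinite type \<open>'i\<close>, these are up to unitary equivalence all block operator
  matrices on Hilbert spaces of dimension at most the cardinality of \<open>'i\<close>.
\<close>

record ('i, 'x) block_op =
  dom_ix :: "'i set"
  cod_ix :: "'i set"
  block :: "'x \<Rightarrow> 'x \<Rightarrow> ('i, 'i) oper"

definition bi_isometry :: "('i, 'x::finite) block_op \<Rightarrow> bool"
  where "bi_isometry V \<longleftrightarrow>
    (let H = dom_ix V; K = cod_ix V; v = block V in
      (\<forall>a x. v a x \<in> bop H K) \<and>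
      (\<forall>x x'. (\<Sum>a\<in>UNIV. adj H K (v a x) \<circ> v a x') = (if x = x' then idop H else 0)) \<and>
      (\<forall>a a'. (\<Sum>x\<in>UNIV. adj H K (v a x) \<circ> v a' x) = (if a = a' then idop H else 0)))"

definition unitarily_equivalent ::
    "('i, 'x::finite) block_op \<Rightarrow> ('i, 'x) block_op \<Rightarrow> bool"
  where "unitarily_equivalent V W \<longleftrightarrow>
    (\<exists>U U'. unitary_op (dom_ix V) (dom_ix W) U \<and> unitary_op (cod_ix V) (cod_ix W) U' \<and>
      (\<forall>a x. block W a x \<circ> U = U' \<circ> block V a x))"

definition bi_isometry_representatives :: "('i, 'x::finite) block_op set \<Rightarrow> bool"
  where "bi_isometry_representatives R \<longleftrightarrow>
    (\<forall>V\<in>R. bi_isometry V) \<and> (\<forall>V. bi_isometry V \<longrightarrow> (\<exists>!W. W \<in> R \<and> unitarily_equivalent V W))"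

text \<open>
  The Hilbert space direct sums of the domains and of the codomains are the \<open>\<ell>\<^sup>2\<close>-spaces over the
  disjoint unions of the index sets.
\<close>

abbreviation univ_dom :: "('i, 'x) block_op set \<Rightarrow> (('i, 'x) block_op \<times> 'i) set"
  where "univ_dom R \<equiv> Sigma R dom_ix"

abbreviation univ_cod :: "('i, 'x) block_op set \<Rightarrow> (('i, 'x) block_op \<times> 'i) set"
  where "univ_cod R \<equiv> Sigma R cod_ix"

definition univ_v :: "('i, 'x) block_op set \<Rightarrow> 'x \<Rightarrow> 'x \<Rightarrow>
    (('i, 'x) block_op \<times> 'i, ('i, 'x) block_op \<times> 'i) oper"
  where "univ_v R a x f = (if f \<in> l2 (univ_dom R)
    then (\<lambda>(V, k). if V \<in> R then block V a x (\<lambda>i. f (V, i)) k else 0) else 0)"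

definition univ_e :: "('i, 'x) block_op set \<Rightarrow> 'x \<Rightarrow> 'x \<Rightarrow> 'x \<Rightarrow> 'x \<Rightarrow>
    (('i, 'x) block_op \<times> 'i, ('i, 'x) block_op \<times> 'i) oper"
  where "univ_e R x x' a a' = adj (univ_dom R) (univ_cod R) (univ_v R a x) \<circ> univ_v R a' x'"

definition C_system :: "('i, 'x) block_op set \<Rightarrow>
    (('i, 'x) block_op \<times> 'i, ('i, 'x) block_op \<times> 'i) oper matrix_ordered"
  where "C_system R = subsystem (B_system (univ_dom R))
    (cstar_generated (univ_dom R) {univ_e R x x' a a' | x x' a a'. True})"

definition T_system :: "('i, 'x) block_op set \<Rightarrow>
    (('i, 'x) block_op \<times> 'i, ('i, 'x) block_op \<times> 'i) oper matrix_ordered"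
  where "T_system R = subsystem (C_system R)
    (complex_vector.span {univ_e R x x' a a' | x x' a a'. True})"


section \<open>The operator system of the marginal conditions\<close>

definition matrix_unit :: "'x \<Rightarrow> 'x \<Rightarrow> complex ^ 'x::finite ^ 'x"
  where "matrix_unit x x' = (\<chi> y y'. if y = x \<and> y' = x' then 1 else 0)"

text \<open>The Kronecker product identifies \<open>M\<^sub>X \<otimes> M\<^sub>X\<close> with the matrices indexed by \<open>X \<times> X\<close>.\<close>

definition kronecker :: "complex ^ 'x ^ 'x \<Rightarrow> complex ^ 'y ^ 'y \<Rightarrow>
    complex ^ ('x::finite \<times> 'y::finite) ^ ('x \<times> 'y)"
  where "kronecker A B = (\<chi> p q. A $ fst p $ fst q * B $ snd p $ snd q)"

definition coeff_matrix :: "('x \<Rightarrow> 'x \<Rightarrow> 'x \<Rightarrow> 'x \<Rightarrow> complex) \<Rightarrow>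
    complex ^ ('x::finite \<times> 'x) ^ ('x \<times> 'x)"
  where "coeff_matrix l = (\<Sum>x\<in>UNIV. \<Sum>x'\<in>UNIV. \<Sum>a\<in>UNIV. \<Sum>a'\<in>UNIV.
    l x x' a a' *\<^sub>C kronecker (matrix_unit x x') (matrix_unit a a'))"

definition L_system :: "(complex ^ ('x::finite \<times> 'x) ^ ('x \<times> 'x)) matrix_ordered"
  where "L_system = subsystem matrix_system {coeff_matrix l | l. \<exists>c.
    (\<forall>x x'. (\<Sum>b\<in>UNIV. l x x' b b) = (if x = x' then c else 0)) \<and>
    (\<forall>a a'. (\<Sum>y\<in>UNIV. l y y a a') = (if a = a' then c else 0))}"

definition Lambda_map :: "('i, 'x::finite) block_op set \<Rightarrow>
    ((('i, 'x) block_op \<times> 'i, ('i, 'x) block_op \<times> 'i) oper \<Rightarrow> complex) \<Rightarrow>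
    complex ^ ('x \<times> 'x) ^ ('x \<times> 'x)"
  where "Lambda_map R \<phi> = coeff_matrix (\<lambda>x x' a a'. \<phi> (univ_e R x x' a a'))"

end

theory Submission
  imports Defs
begin

text \<open>
  Write \<open>\<lambda>\<^sub>p\<^sub>,\<^sub>q\<close> for the entries of a matrix, with \<open>p = (x, a)\<close> and \<open>q = (x', a')\<close>, and
  \<open>e\<^sub>p\<^sub>,\<^sub>q = v\<^sub>a\<^sub>,\<^sub>x\<^sup>*v\<^sub>a\<^sub>'\<^sub>,\<^sub>x\<^sub>'\<close> for the generators of the universal system.

  One half of the theorem is formal. The relations of a bi-isometry say that
  \<open>\<Sum>\<^sub>a e\<close> and \<open>\<Sum>\<^sub>x e\<close> are \<open>\<delta>\<close> times the identity, so the matrix of a functional \<open>\<phi>\<close> satisfies the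
  marginal conditions with \<open>c = \<phi>(1)\<close>. The generators span, so \<open>\<phi>\<close> is determined by its matrix.
  The matrix \<open>(e\<^sub>p\<^sub>,\<^sub>q)\<close> is positive, being \<open>V\<^sup>*V\<close> for a row \<open>V\<close> of operators, so a completely positive
  family of functionals is sent to a positive matrix (\<open>Lambda_map_mcone\<close>).

  The other half is a dilation argument: a positive element \<open>(\<lambda>\<^sub>i\<^sub>j)\<close> of \<open>M\<^sub>n(\<L>\<^sub>X)\<close> must come from a
  completely positive map on \<open>\<T>\<^sub>X\<close>. As a positive kernel in the indices \<open>(i, p)\<close> it is a Gram matrix of
  vectors \<open>w\<^sub>i\<^sub>,\<^sub>x\<^sub>,\<^sub>a\<close>. The marginal conditions with constants \<open>c\<^sub>i\<^sub>j\<close> say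
  \<open>\<Sum>\<^sub>a \<langle>w\<^sub>i\<^sub>,\<^sub>x\<^sub>,\<^sub>a, w\<^sub>j\<^sub>,\<^sub>x\<^sub>'\<^sub>,\<^sub>a\<rangle> = \<delta> c\<^sub>i\<^sub>j\<close> for \<open>\<delta> = \<delta>\<^sub>x\<^sub>,\<^sub>x\<^sub>'\<close>, and likewise for the sum over \<open>x\<close>.
  Hence \<open>(c\<^sub>i\<^sub>j)\<close> is positive as well, and it is the Gram matrix of a spanning family \<open>b\<^sub>i\<close> of a finite
  dimensional Hilbert space. The two conditions now say exactly that \<open>V\<^sub>a\<^sub>,\<^sub>x b\<^sub>i = w\<^sub>i\<^sub>,\<^sub>x\<^sub>,\<^sub>a\<close>
  defines a bi-isometry (\<open>bi_isometry_realising_kernel\<close>). The spanning family replaces the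
  square root of \<open>(c\<^sub>i\<^sub>j)\<close>, which need not be invertible. A unitary copy of \<open>V\<close> is a summand of the
  universal bi-isometry; the vectors \<open>b\<^sub>i\<close> become vectors \<open>\<eta>\<^sub>i\<close> there, and the functionals
  \<open>\<phi>\<^sub>i\<^sub>j(u) = \<langle>\<eta>\<^sub>i, u \<eta>\<^sub>j\<rangle>\<close> have the required values on the generators (\<open>mcone_L_lift\<close>). They form a
  compression of the identity representation and are therefore completely positive.

  That every matrix in \<open>\<L>\<^sub>X\<close>, positive or not, is attained follows from the same construction for \<open>n = 2\<close>:
  any \<open>\<lambda>\<close> is the corner of a positive block matrix whose diagonal blocks are a large multiple of the
  identity (\<open>Lambda_map_surj\<close>).

  The analysis behind this is elementary because all Hilbert spaces are of the form \<open>\<ell>\<^sup>2(S)\<close>: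
  adjoints are given by their matrix entries, and operator identities are tested on basis vectors.
\<close>

section \<open>Square-summable functions\<close>

lemma scaleC_apply [simp]: "(c *\<^sub>C f) i = c *\<^sub>C f i"
  by (simp add: scaleC_fun_def)

lemma sum_apply: "(\<Sum>k\<in>A. f k) i = (\<Sum>k\<in>A. f k i)"
  by (induction A rule: infinite_finite_induct) auto

definition ket :: "'i \<Rightarrow> 'i \<Rightarrow> complex"
  where "ket i = (\<lambda>j. if j = i then 1 else 0)"

lemma l2_summable: "f \<in> l2 S \<Longrightarrow> (\<lambda>i. (cmod (f i))\<^sup>2) summable_on UNIV"
  by (simp add: l2_def)

lemma l2_off: "f \<in> l2 S \<Longrightarrow> i \<notin> S \<Longrightarrow> f i = 0"
  by (simp add: l2_def)

lemma l2_abs_summable: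
  assumes "f \<in> l2 S" "g \<in> l2 T"
  shows "(\<lambda>i. norm (cnj (f i) * g i)) summable_on UNIV"
proof (rule summable_on_comparison_test)
  show "(\<lambda>i. (cmod (f i))\<^sup>2 + (cmod (g i))\<^sup>2) summable_on UNIV"
    using assms by (intro summable_on_add l2_summable)
  fix i
  have "2 * (cmod (f i) * cmod (g i)) \<le> (cmod (f i))\<^sup>2 + (cmod (g i))\<^sup>2"
    using sum_squares_bound[of "cmod (f i)" "cmod (g i)"] by simp
  moreover have "0 \<le> cmod (f i) * cmod (g i)" by simp
  ultimately show "norm (cnj (f i) * g i) \<le> (cmod (f i))\<^sup>2 + (cmod (g i))\<^sup>2"
    unfolding norm_mult complex_mod_cnj by linarith
qed simp

lemma l2_mult_summable:
  assumes "f \<in> l2 S" "g \<in> l2 T"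
  shows "(\<lambda>i. cnj (f i) * g i) summable_on UNIV"
  using l2_abs_summable[OF assms] by (rule abs_summable_summable)

lemma l2_zero [simp]: "0 \<in> l2 S"
  by (simp add: l2_def)

lemma l2_scale: "f \<in> l2 S \<Longrightarrow> c *\<^sub>C f \<in> l2 S"
  by (auto simp: l2_def norm_mult power_mult_distrib intro: summable_on_cmult_right)

lemma l2_add:
  assumes "f \<in> l2 S" "g \<in> l2 S" shows "f + g \<in> l2 S"
proof -
  have "(\<lambda>i. (cmod ((f + g) i))\<^sup>2) summable_on UNIV"
  proof (rule summable_on_comparison_test)
    show "(\<lambda>i. 2 * (cmod (f i))\<^sup>2 + 2 * (cmod (g i))\<^sup>2) summable_on UNIV"
      using assms by (intro summable_on_add summable_on_cmult_right l2_summable)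
    fix i
    have "(cmod (f i + g i))\<^sup>2 \<le> (cmod (f i) + cmod (g i))\<^sup>2"
      by (intro power_mono norm_triangle_ineq) simp
    also have "\<dots> \<le> 2 * (cmod (f i))\<^sup>2 + 2 * (cmod (g i))\<^sup>2"
      using sum_squares_bound[of "cmod (f i)" "cmod (g i)"] by (simp add: power2_sum)
    finally show "(cmod ((f + g) i))\<^sup>2 \<le> 2 * (cmod (f i))\<^sup>2 + 2 * (cmod (g i))\<^sup>2"
      by simp
  qed simp
  then show ?thesis using assms by (simp add: l2_def)
qed

lemma l2_diff:
  assumes "f \<in> l2 S" "g \<in> l2 S" shows "f - g \<in> l2 S"
proof -
  have "f - g = f + (-1) *\<^sub>C g" by (auto simp: fun_eq_iff)
  then show ?thesis using assms by (simp only: l2_add l2_scale)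
qed

lemma l2_sum: "(\<And>k. k \<in> A \<Longrightarrow> f k \<in> l2 S) \<Longrightarrow> (\<Sum>k\<in>A. f k) \<in> l2 S"
  by (induction A rule: infinite_finite_induct) (auto simp: l2_add)

lemma l2_finite_support:
  assumes "finite F" "\<And>i. i \<notin> F \<Longrightarrow> f i = 0" "\<And>i. i \<notin> S \<Longrightarrow> f i = 0"
  shows "f \<in> l2 S"
proof -
  have "(\<lambda>i. (cmod (f i))\<^sup>2) summable_on F" using assms by simp
  then have "(\<lambda>i. (cmod (f i))\<^sup>2) summable_on UNIV"
    by (subst summable_on_cong_neutral[where T = F]) (use assms in auto)
  then show ?thesis using assms by (simp add: l2_def)
qed

lemma l2_ket: "i \<in> S \<Longrightarrow> ket i \<in> l2 S"
  by (rule l2_finite_support[of "{i}"]) (auto simp: ket_def)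

lemma l2_inner_finite_support:
  assumes "finite F" "\<And>i. i \<notin> F \<Longrightarrow> f i = 0 \<or> g i = 0"
  shows "l2_inner f g = (\<Sum>i\<in>F. cnj (f i) * g i)"
proof -
  have "l2_inner f g = (\<Sum>\<^sub>\<infinity>i\<in>F. cnj (f i) * g i)"
    unfolding l2_inner_def by (rule infsum_cong_neutral) (use assms in force)+
  then show ?thesis using assms by simp
qed

lemma l2_inner_ket: "l2_inner (ket i) g = g i"
  by (subst l2_inner_finite_support[of "{i}"]) (auto simp: ket_def)

lemma l2_inner_add_right:
  assumes "f \<in> l2 S" "g \<in> l2 T" "h \<in> l2 T"
  shows "l2_inner f (g + h) = l2_inner f g + l2_inner f h"
  unfolding l2_inner_def using assms
  by (simp add: distrib_left infsum_add[symmetric] l2_mult_summable)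

lemma l2_inner_scale_right: "l2_inner f (c *\<^sub>C g) = c * l2_inner f g"
  unfolding l2_inner_def by (simp add: infsum_cmult_right'[symmetric] mult_ac)

lemma l2_inner_commute: "l2_inner g f = cnj (l2_inner f g)"
  unfolding l2_inner_def infsum_cnj[symmetric] by (simp add: mult.commute)

lemma l2_inner_zero [simp]: "l2_inner f 0 = 0" "l2_inner 0 f = 0"
  by (simp_all add: l2_inner_def)

lemma l2_inner_add_left:
  assumes "f \<in> l2 S" "g \<in> l2 T" "h \<in> l2 T"
  shows "l2_inner (g + h) f = l2_inner g f + l2_inner h f"
  unfolding l2_inner_commute[of _ f] l2_inner_add_right[OF assms] by simp

lemma l2_inner_scale_left: "l2_inner (c *\<^sub>C g) f = cnj c * l2_inner g f"
  unfolding l2_inner_commute[of _ f] l2_inner_scale_right by simp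

lemma l2_inner_diff_right:
  assumes "f \<in> l2 S" "g \<in> l2 T" "h \<in> l2 T"
  shows "l2_inner f (g - h) = l2_inner f g - l2_inner f h"
proof -
  have "l2_inner f ((g - h) + h) = l2_inner f (g - h) + l2_inner f h"
    using assms by (intro l2_inner_add_right[where S = S and T = T] l2_diff)
  then show ?thesis by simp
qed

lemma l2_inner_diff_left:
  assumes "f \<in> l2 S" "g \<in> l2 T" "h \<in> l2 T"
  shows "l2_inner (g - h) f = l2_inner g f - l2_inner h f"
  unfolding l2_inner_commute[of _ f] l2_inner_diff_right[OF assms] by simp

lemma l2_inner_sum_right:
  assumes "f \<in> l2 S" "\<And>k. k \<in> A \<Longrightarrow> g k \<in> l2 T"
  shows "l2_inner f (\<Sum>k\<in>A. g k) = (\<Sum>k\<in>A. l2_inner f (g k))"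
  using assms
  by (induction A rule: infinite_finite_induct) (auto simp: l2_sum l2_inner_add_right[where S = S and T = T])

lemma l2_inner_sum_left:
  assumes "f \<in> l2 S" "\<And>k. k \<in> A \<Longrightarrow> g k \<in> l2 T"
  shows "l2_inner (\<Sum>k\<in>A. g k) f = (\<Sum>k\<in>A. l2_inner (g k) f)"
  using assms
  by (induction A rule: infinite_finite_induct) (auto simp: l2_sum l2_inner_add_left[where S = S and T = T])

lemma l2_norm_nonneg [simp]: "0 \<le> l2_norm f"
  by (simp add: l2_norm_def infsum_nonneg)

lemma l2_norm_sq: "(l2_norm f)\<^sup>2 = (\<Sum>\<^sub>\<infinity>i. (cmod (f i))\<^sup>2)"
  by (simp add: l2_norm_def infsum_nonneg)

lemma cnj_mult_self: "cnj z * z = of_real ((cmod z)\<^sup>2)"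
  by (metis complex_norm_square mult.commute)

lemma l2_inner_self:
  assumes "f \<in> l2 S" shows "l2_inner f f = of_real ((l2_norm f)\<^sup>2)"
proof -
  have "((\<lambda>i. complex_of_real ((cmod (f i))\<^sup>2)) has_sum of_real ((l2_norm f)\<^sup>2)) UNIV"
    unfolding l2_norm_sq by (intro has_sum_of_real has_sum_infsum l2_summable[OF assms])
  then show ?thesis by (simp only: l2_inner_def cnj_mult_self infsumI)
qed

lemma l2_inner_self_nonneg: "f \<in> l2 S \<Longrightarrow> l2_inner f f \<in> \<real>\<^sub>\<ge>\<^sub>0"
  by (simp add: l2_inner_self)

lemma sum_le_l2_norm_sq:
  assumes "f \<in> l2 S" "finite F"
  shows "(\<Sum>i\<in>F. (cmod (f i))\<^sup>2) \<le> (l2_norm f)\<^sup>2"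
  unfolding l2_norm_sq using assms by (intro finite_sum_le_infsum l2_summable) auto

text \<open>
  Bounding finite partial sums yields square-summability and the norm estimate at once, so that
  a vector given only by its coordinates can be shown to belong to \<open>\<ell>\<^sup>2(S)\<close>.
\<close>

lemma l2_boundedI:
  assumes "\<And>i. i \<notin> S \<Longrightarrow> f i = 0" "\<And>F. finite F \<Longrightarrow> (\<Sum>i\<in>F. (cmod (f i))\<^sup>2) \<le> c\<^sup>2" "0 \<le> c"
  shows "f \<in> l2 S" "l2_norm f \<le> c"
proof -
  have sm: "(\<lambda>i. (cmod (f i))\<^sup>2) summable_on UNIV"
    by (rule nonneg_bdd_above_summable_on) (use assms(2) in \<open>auto simp: bdd_above_def\<close>)
  then show "f \<in> l2 S" using assms by (simp add: l2_def)
  have "(l2_norm f)\<^sup>2 \<le> c\<^sup>2"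
    unfolding l2_norm_sq by (rule infsum_le_finite_sums[OF sm]) (use assms in auto)
  then show "l2_norm f \<le> c" using assms(3) by (rule power2_le_imp_le)
qed

lemma l2_Cauchy_Schwarz:
  assumes "f \<in> l2 S" "g \<in> l2 T"
  shows "cmod (l2_inner f g) \<le> l2_norm f * l2_norm g"
proof -
  have "cmod (l2_inner f g) \<le> (\<Sum>\<^sub>\<infinity>i. cmod (cnj (f i) * g i))"
    unfolding l2_inner_def by (rule norm_infsum_bound[OF l2_abs_summable[OF assms]])
  also have "\<dots> \<le> l2_norm f * l2_norm g"
  proof (rule infsum_le_finite_sums[OF l2_abs_summable[OF assms]])
    fix F :: "'a set" assume F: "finite F"
    have "(\<Sum>i\<in>F. cmod (cnj (f i) * g i)) \<le> L2_set (\<lambda>i. cmod (f i)) F * L2_set (\<lambda>i. cmod (g i)) F"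
      using L2_set_mult_ineq[of "\<lambda>i. cmod (f i)" "\<lambda>i. cmod (g i)" F] by (simp add: norm_mult)
    also have "\<dots> \<le> l2_norm f * l2_norm g"
    proof (rule mult_mono)
      show "L2_set (\<lambda>i. cmod (f i)) F \<le> l2_norm f" "L2_set (\<lambda>i. cmod (g i)) F \<le> l2_norm g"
        unfolding L2_set_def
        by (rule real_le_lsqrt[OF l2_norm_nonneg sum_le_l2_norm_sq[OF assms(1) F]]
            real_le_lsqrt[OF l2_norm_nonneg sum_le_l2_norm_sq[OF assms(2) F]])+
    qed simp_all
    finally show "(\<Sum>i\<in>F. cmod (cnj (f i) * g i)) \<le> l2_norm f * l2_norm g" .
  qed
  finally show ?thesis .
qed

lemma l2_inner_eqI:
  assumes "f \<in> l2 S" "g \<in> l2 S" "\<And>h. h \<in> l2 S \<Longrightarrow> l2_inner h f = l2_inner h g"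
  shows "f = g"
proof
  fix i show "f i = g i"
  proof (cases "i \<in> S")
    case True
    then show ?thesis using assms(3)[OF l2_ket] by (simp add: l2_inner_ket)
  next
    case False
    then show ?thesis using assms(1,2) by (simp add: l2_off)
  qed
qed

text \<open>
  By this density statement, identities between bounded operators extend from finite combinations of
  basis vectors to the whole space.
\<close>

lemma l2_truncation:
  assumes "f \<in> l2 S" "0 < e"
  obtains F where "finite F" "F \<subseteq> S" "l2_norm (f - (\<Sum>i\<in>F. f i *\<^sub>C ket i)) \<le> e"
proof -
  obtain G where G: "finite G"
    "dist (\<Sum>i\<in>G. (cmod (f i))\<^sup>2) (\<Sum>\<^sub>\<infinity>i. (cmod (f i))\<^sup>2) \<le> e\<^sup>2"
    using infsum_finite_approximation[OF l2_summable[OF assms(1)], of "e\<^sup>2"] assms(2) by auto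
  define h where "h = f - (\<Sum>i\<in>G \<inter> S. f i *\<^sub>C ket i)"
  have h: "h j = (if j \<in> G then 0 else f j)" for j
    using G(1) l2_off[OF assms(1)]
    by (auto simp: h_def sum_apply ket_def if_distrib sum.delta cong: if_cong)
  have "(l2_norm h)\<^sup>2 = (\<Sum>\<^sub>\<infinity>i\<in>UNIV - G. (cmod (f i))\<^sup>2)"
    unfolding l2_norm_sq by (rule infsum_cong_neutral) (auto simp: h)
  also have "\<dots> = (\<Sum>\<^sub>\<infinity>i. (cmod (f i))\<^sup>2) - (\<Sum>i\<in>G. (cmod (f i))\<^sup>2)"
    using infsum_Diff[OF l2_summable[OF assms(1)], of G] G(1) by simp
  also have "\<dots> \<le> e\<^sup>2" using G(2) by (simp add: dist_real_def)
  finally have "l2_norm h \<le> e" by (rule power2_le_imp_le) (use assms(2) in simp)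
  then show ?thesis using that[of "G \<inter> S"] G(1) by (auto simp: h_def)
qed

section \<open>Bounded operators and their adjoints\<close>

lemma bop_add: "A \<in> bop S T \<Longrightarrow> f \<in> l2 S \<Longrightarrow> g \<in> l2 S \<Longrightarrow> A (f + g) = A f + A g"
  and bop_scale: "A \<in> bop S T \<Longrightarrow> f \<in> l2 S \<Longrightarrow> A (c *\<^sub>C f) = c *\<^sub>C A f"
  and bop_l2: "A \<in> bop S T \<Longrightarrow> f \<in> l2 S \<Longrightarrow> A f \<in> l2 T"
  and bop_off: "A \<in> bop S T \<Longrightarrow> f \<notin> l2 S \<Longrightarrow> A f = 0"
  by (auto simp: bop_def clinear_on_def)

lemma bop_zero: "A \<in> bop S T \<Longrightarrow> A 0 = 0"
  using bop_add[of A S T 0 0] by simp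

lemma bop_diff:
  assumes "A \<in> bop S T" "f \<in> l2 S" "g \<in> l2 S" shows "A (f - g) = A f - A g"
proof -
  have "A f = A (f - g) + A g" using assms by (metis bop_add diff_add_cancel l2_diff)
  then show ?thesis by simp
qed

lemma bop_sum:
  assumes "A \<in> bop S T" "\<And>k. k \<in> F \<Longrightarrow> f k \<in> l2 S"
  shows "A (\<Sum>k\<in>F. f k) = (\<Sum>k\<in>F. A (f k))"
  using assms
  by (induction F rule: infinite_finite_induct) (auto simp: bop_zero bop_add l2_sum)

lemma bop_bound:
  assumes "A \<in> bop S T"
  obtains c where "0 \<le> c" "\<And>f. f \<in> l2 S \<Longrightarrow> l2_norm (A f) \<le> c * l2_norm f"
proof -
  obtain c where c: "\<forall>f\<in>l2 S. l2_norm (A f) \<le> c * l2_norm f"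
    using assms by (auto simp: bop_def)
  have "c * l2_norm f \<le> \<bar>c\<bar> * l2_norm f" for f :: "'a \<Rightarrow> complex"
    by (intro mult_right_mono) auto
  then show ?thesis using c that[of "\<bar>c\<bar>"] by (meson abs_ge_zero order_trans)
qed

lemma bopI:
  assumes "\<And>f g. f \<in> l2 S \<Longrightarrow> g \<in> l2 S \<Longrightarrow> A (f + g) = A f + A g"
    and "\<And>c f. f \<in> l2 S \<Longrightarrow> A (c *\<^sub>C f) = c *\<^sub>C A f"
    and "\<And>f. f \<in> l2 S \<Longrightarrow> A f \<in> l2 T"
    and "\<And>f. f \<in> l2 S \<Longrightarrow> l2_norm (A f) \<le> c * l2_norm f"
    and "\<And>f. f \<notin> l2 S \<Longrightarrow> A f = 0"
  shows "A \<in> bop S T"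
  using assms unfolding bop_def clinear_on_def by blast

lemma bop_comp:
  assumes "A \<in> bop S T" "B \<in> bop T U" shows "B \<circ> A \<in> bop S U"
proof -
  obtain a where a: "0 \<le> a" "\<And>f. f \<in> l2 S \<Longrightarrow> l2_norm (A f) \<le> a * l2_norm f"
    using bop_bound[OF assms(1)] by blast
  obtain b where b: "0 \<le> b" "\<And>f. f \<in> l2 T \<Longrightarrow> l2_norm (B f) \<le> b * l2_norm f"
    using bop_bound[OF assms(2)] by blast
  show ?thesis
  proof (rule bopI[where c = "b * a"])
    fix f assume f: "f \<in> l2 S"
    have "l2_norm (B (A f)) \<le> b * l2_norm (A f)" using b bop_l2[OF assms(1) f] by blast
    also have "\<dots> \<le> b * (a * l2_norm f)" using a b f by (intro mult_left_mono) auto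
    finally show "l2_norm ((B \<circ> A) f) \<le> b * a * l2_norm f" by (simp add: mult_ac)
  next
    fix f assume "f \<notin> l2 S"
    then show "(B \<circ> A) f = 0" using bop_off[OF assms(1)] bop_zero[OF assms(2)] by simp
  next
    fix f g assume "f \<in> l2 S" "g \<in> l2 S"
    then show "(B \<circ> A) (f + g) = (B \<circ> A) f + (B \<circ> A) g"
      by (simp only: o_apply bop_add[OF assms(1)] bop_add[OF assms(2) bop_l2[OF assms(1)] bop_l2[OF assms(1)]])
  next
    fix c f assume "f \<in> l2 S"
    then show "(B \<circ> A) (c *\<^sub>C f) = c *\<^sub>C (B \<circ> A) f"
      by (simp only: o_apply bop_scale[OF assms(1)] bop_scale[OF assms(2) bop_l2[OF assms(1)]])
  next
    fix f assume "f \<in> l2 S"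
    then show "(B \<circ> A) f \<in> l2 U"
      by (simp only: o_apply bop_l2[OF assms(1)] bop_l2[OF assms(2)])
  qed
qed

text \<open>
  The entries of the adjoint are forced: \<open>(A\<^sup>*g)\<^sub>i = \<langle>A e\<^sub>i, g\<rangle>\<close> for the basis vectors \<open>e\<^sub>i\<close>. For a
  truncation \<open>h\<close> of this vector, \<open>\<parallel>h\<parallel>\<^sup>2 = \<langle>A h, g\<rangle> \<le> c \<parallel>h\<parallel> \<parallel>g\<parallel>\<close> with \<open>c\<close> a bound for \<open>A\<close>, so all
  truncations have norm at most \<open>c \<parallel>g\<parallel>\<close>. This gives square-summability and boundedness without the
  Riesz representation theorem.
\<close>

lemma adj_exists:
  assumes A: "A \<in> bop S T"
  shows "\<exists>B\<in>bop T S. \<forall>f\<in>l2 S. \<forall>g\<in>l2 T. l2_inner (A f) g = l2_inner f (B g)"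
proof -
  obtain c where c: "0 \<le> c" "\<And>f. f \<in> l2 S \<Longrightarrow> l2_norm (A f) \<le> c * l2_norm f"
    using bop_bound[OF A] by blast
  define B where "B = (\<lambda>g. if g \<in> l2 T then (\<lambda>i. if i \<in> S then l2_inner (A (ket i)) g else 0) else 0)"
  have trunc: "l2_inner (A (\<Sum>i\<in>F. h i *\<^sub>C ket i)) g = (\<Sum>i\<in>F. cnj (h i) * B g i)"
    if "F \<subseteq> S" "g \<in> l2 T" for F h g
  proof -
    have k: "ket i \<in> l2 S" if "i \<in> F" for i using that \<open>F \<subseteq> S\<close> by (auto intro: l2_ket)
    have "A (\<Sum>i\<in>F. h i *\<^sub>C ket i) = (\<Sum>i\<in>F. h i *\<^sub>C A (ket i))"
      by (subst bop_sum[OF A]) (auto simp: k l2_scale bop_scale[OF A])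
    then have "l2_inner (A (\<Sum>i\<in>F. h i *\<^sub>C ket i)) g = l2_inner (\<Sum>i\<in>F. h i *\<^sub>C A (ket i)) g"
      by simp
    also have "\<dots> = (\<Sum>i\<in>F. l2_inner (h i *\<^sub>C A (ket i)) g)"
      by (rule l2_inner_sum_left[where S = T and T = T]) (use that k bop_l2[OF A] in \<open>auto simp: l2_scale\<close>)
    also have "\<dots> = (\<Sum>i\<in>F. cnj (h i) * B g i)"
      by (rule sum.cong) (use that in \<open>auto simp: l2_inner_scale_left B_def\<close>)
    finally show ?thesis .
  qed
  have Bl2: "B g \<in> l2 S" and Bnorm: "l2_norm (B g) \<le> c * l2_norm g" if g: "g \<in> l2 T" for g
  proof -
    have fin: "(\<Sum>i\<in>F. (cmod (B g i))\<^sup>2) \<le> (c * l2_norm g)\<^sup>2" if F: "finite F" for F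
    proof -
      \<comment> \<open>The truncation of \<open>B g\<close> to \<open>F\<close>.\<close>
      define h where "h = (\<Sum>i\<in>F \<inter> S. B g i *\<^sub>C ket i)"
      have hi: "h j = (if j \<in> F then B g j else 0)" for j
        using F by (auto simp: h_def sum_apply ket_def if_distrib sum.delta B_def cong: if_cong)
      have hS: "h \<in> l2 S" unfolding h_def by (intro l2_sum l2_scale l2_ket) auto
      define N where "N = (\<Sum>i\<in>F. (cmod (B g i))\<^sup>2)"
      have "l2_inner h h = of_real N"
        by (subst l2_inner_finite_support[OF F])
          (simp_all only: hi N_def if_True cnj_mult_self of_real_sum if_False simp_thms cong: sum.cong)
      then have N: "(l2_norm h)\<^sup>2 = N" by (simp add: l2_inner_self[OF hS] del: of_real_power)
      have "l2_inner (A h) g = (\<Sum>i\<in>F \<inter> S. cnj (B g i) * B g i)"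
        unfolding h_def by (rule trunc) (use g in auto)
      also have "\<dots> = (\<Sum>i\<in>F. cnj (B g i) * B g i)"
        by (rule sum.mono_neutral_left) (auto simp: F B_def)
      also have "\<dots> = of_real N"
        by (simp only: N_def cnj_mult_self of_real_sum)
      finally have "cmod (l2_inner (A h) g) = N"
        by (simp only: norm_of_real) (simp add: N_def sum_nonneg)
      then have "(l2_norm h)\<^sup>2 \<le> l2_norm (A h) * l2_norm g"
        using l2_Cauchy_Schwarz[OF bop_l2[OF A hS] g] N by simp
      also have "\<dots> \<le> c * l2_norm h * l2_norm g"
        by (intro mult_right_mono c hS) simp
      finally have "l2_norm h * l2_norm h \<le> l2_norm h * (c * l2_norm g)"
        by (simp add: power2_eq_square mult_ac)
      then have "l2_norm h \<le> c * l2_norm g"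
        using c(1) l2_norm_nonneg[of h] l2_norm_nonneg[of g]
        by (cases "l2_norm h = 0") (auto simp: mult_le_cancel_left)
      then show ?thesis unfolding N_def[symmetric] N[symmetric] by (intro power_mono) auto
    qed
    have off: "B g i = 0" if "i \<notin> S" for i using that by (simp add: B_def)
    have "0 \<le> c * l2_norm g" using c(1) by simp
    from l2_boundedI[OF off fin this]
    show "B g \<in> l2 S" "l2_norm (B g) \<le> c * l2_norm g" by auto
  qed
  have Bop: "B \<in> bop T S"
  proof (rule bopI[where c = c])
    fix f g assume fg: "f \<in> l2 T" "g \<in> l2 T"
    have "l2_inner (A (ket i)) (f + g) = l2_inner (A (ket i)) f + l2_inner (A (ket i)) g"
      if "i \<in> S" for i
      by (rule l2_inner_add_right[OF bop_l2[OF A l2_ket[OF that]] fg])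
    then show "B (f + g) = B f + B g" using fg by (simp add: B_def l2_add fun_eq_iff)
  next
    fix d f assume "f \<in> l2 T"
    then show "B (d *\<^sub>C f) = d *\<^sub>C B f"
      by (simp add: B_def fun_eq_iff l2_scale l2_inner_scale_right)
  next
    fix f assume "f \<in> l2 T"
    then show "B f \<in> l2 S" "l2_norm (B f) \<le> c * l2_norm f" by (rule Bl2 Bnorm)+
  qed (simp add: B_def)
  \<comment> \<open>Both sides are continuous in \<open>f\<close>, so it suffices to compare them on truncations of \<open>f\<close>.\<close>
  have "l2_inner (A f) g = l2_inner f (B g)" if f: "f \<in> l2 S" and g: "g \<in> l2 T" for f g
  proof -
    define M where "M = c * l2_norm g + l2_norm (B g)"
    have M: "0 \<le> M" using c by (simp add: M_def)
    have "cmod (l2_inner (A f) g - l2_inner f (B g)) \<le> e * M" if e: "0 < e" for e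
    proof -
      obtain F where F: "finite F" "F \<subseteq> S" "l2_norm (f - (\<Sum>i\<in>F. f i *\<^sub>C ket i)) \<le> e"
        by (rule l2_truncation[OF f e])
      define t where "t = (\<Sum>i\<in>F. f i *\<^sub>C ket i)"
      have t: "t \<in> l2 S" unfolding t_def using F by (intro l2_sum l2_scale l2_ket) auto
      have d: "f - t \<in> l2 S" by (rule l2_diff[OF f t])
      have ti: "t j = (if j \<in> F then f j else 0)" for j
        using F by (auto simp: t_def sum_apply ket_def if_distrib sum.delta cong: if_cong)
      have "l2_inner (A t) g = (\<Sum>i\<in>F. cnj (f i) * B g i)"
        unfolding t_def by (rule trunc[OF F(2) g])
      also have "\<dots> = l2_inner t (B g)"
        by (subst l2_inner_finite_support[OF F(1)]) (auto simp: ti)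
      finally have "l2_inner (A t) g = l2_inner t (B g)" .
      then have "l2_inner (A f) g - l2_inner f (B g) = l2_inner (A (f - t)) g - l2_inner (f - t) (B g)"
        unfolding bop_diff[OF A f t] l2_inner_diff_left[OF g bop_l2[OF A f] bop_l2[OF A t]]
          l2_inner_diff_left[OF Bl2[OF g] f t] by (simp only: diff_diff_eq2 diff_add_cancel)
      also have "cmod \<dots> \<le> cmod (l2_inner (A (f - t)) g) + cmod (l2_inner (f - t) (B g))"
        by (rule norm_triangle_ineq4)
      also have "\<dots> \<le> l2_norm (A (f - t)) * l2_norm g + l2_norm (f - t) * l2_norm (B g)"
        by (intro add_mono l2_Cauchy_Schwarz[OF bop_l2[OF A d] g] l2_Cauchy_Schwarz[OF d Bl2[OF g]])
      also have "\<dots> \<le> c * l2_norm (f - t) * l2_norm g + l2_norm (f - t) * l2_norm (B g)"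
        by (intro add_mono mult_right_mono c d) auto
      also have "\<dots> = l2_norm (f - t) * M" by (simp add: M_def algebra_simps)
      also have "\<dots> \<le> e * M" using F(3) M by (intro mult_right_mono) (auto simp: t_def)
      finally show ?thesis .
    qed
    note bound = this
    have "cmod (l2_inner (A f) g - l2_inner f (B g)) \<le> 0"
    proof (rule field_le_epsilon)
      fix e :: real assume e: "0 < e"
      have "cmod (l2_inner (A f) g - l2_inner f (B g)) \<le> e / (M + 1) * M"
        using bound[of "e / (M + 1)"] e M by simp
      also have "\<dots> \<le> e" using e M by (simp add: field_simps)
      finally show "cmod (l2_inner (A f) g - l2_inner f (B g)) \<le> 0 + e" by simp
    qed
    then show ?thesis by simp
  qed
  then show ?thesis using Bop by blast
qed

lemma
  assumes "A \<in> bop S T"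
  shows adj_bop: "adj S T A \<in> bop T S"
    and adj_inner: "f \<in> l2 S \<Longrightarrow> g \<in> l2 T \<Longrightarrow> l2_inner f (adj S T A g) = l2_inner (A f) g"
proof -
  obtain B where B: "B \<in> bop T S" "\<forall>f\<in>l2 S. \<forall>g\<in>l2 T. l2_inner (A f) g = l2_inner f (B g)"
    using adj_exists[OF assms] by blast
  have unique: "B' = B"
    if B': "B' \<in> bop T S \<and> (\<forall>f\<in>l2 S. \<forall>g\<in>l2 T. l2_inner (A f) g = l2_inner f (B' g))" for B'
  proof
    fix g show "B' g = B g"
    proof (cases "g \<in> l2 T")
      case True
      show ?thesis
      proof (rule l2_inner_eqI)
        show "B' g \<in> l2 S" by (rule bop_l2[OF conjunct1[OF B'] True])
        show "B g \<in> l2 S" by (rule bop_l2[OF B(1) True])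
        fix h assume h: "h \<in> l2 S"
        have "l2_inner (A h) g = l2_inner h (B' g)"
          by (rule bspec[OF bspec[OF conjunct2[OF B'] h] True])
        moreover have "l2_inner (A h) g = l2_inner h (B g)"
          by (rule bspec[OF bspec[OF B(2) h] True])
        ultimately show "l2_inner h (B' g) = l2_inner h (B g)" by (rule trans[OF sym])
      qed
    next
      case False
      show ?thesis unfolding bop_off[OF conjunct1[OF B'] False] bop_off[OF B(1) False] ..
    qed
  qed
  have "adj S T A = B"
    unfolding adj_def by (rule the_equality) (rule conjI[OF B], rule unique)
  then show "adj S T A \<in> bop T S"
    "f \<in> l2 S \<Longrightarrow> g \<in> l2 T \<Longrightarrow> l2_inner f (adj S T A g) = l2_inner (A f) g"
    using B by (simp_all only:)
qed

section \<open>Bi-isometries\<close>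

lemma sum_adj_comp_inner:
  assumes v: "\<And>a. a \<in> A \<Longrightarrow> v a \<in> bop H K" and w: "\<And>a. a \<in> A \<Longrightarrow> w a \<in> bop H K"
    and f: "f \<in> l2 H" and g: "g \<in> l2 H"
  shows "l2_inner f ((\<Sum>a\<in>A. adj H K (v a) \<circ> w a) g) = (\<Sum>a\<in>A. l2_inner (v a f) (w a g))"
proof -
  have "l2_inner f ((\<Sum>a\<in>A. adj H K (v a) \<circ> w a) g) = l2_inner f (\<Sum>a\<in>A. adj H K (v a) (w a g))"
    by (simp add: sum_apply)
  also have "\<dots> = (\<Sum>a\<in>A. l2_inner f (adj H K (v a) (w a g)))"
    by (rule l2_inner_sum_right[OF f bop_l2[OF adj_bop[OF v] bop_l2[OF w g]]])
  also have "\<dots> = (\<Sum>a\<in>A. l2_inner (v a f) (w a g))"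
    by (rule sum.cong[OF refl]) (rule adj_inner[OF v f bop_l2[OF w g]])
  finally show ?thesis .
qed

text \<open>
  A sum of products of the form \<open>V\<^sup>*W\<close> is determined by its matrix elements, which are inner
  products in the codomain. In this form the defining relations of a bi-isometry avoid adjoints,
  and it suffices to test them against the basis vectors on one side.
\<close>

lemma sum_adj_compI:
  assumes v: "\<And>a. a \<in> A \<Longrightarrow> v a \<in> bop H K" and w: "\<And>a. a \<in> A \<Longrightarrow> w a \<in> bop H K"
    and eq: "\<And>i g. i \<in> H \<Longrightarrow> g \<in> l2 H \<Longrightarrow>
      (\<Sum>a\<in>A. l2_inner (v a (ket i)) (w a g)) = (if P then g i else 0)"
  shows "(\<Sum>a\<in>A. adj H K (v a) \<circ> w a) = (if P then idop H else 0)" (is "?D = _")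
proof
  fix g show "?D g = (if P then idop H else 0) g"
  proof (cases "g \<in> l2 H")
    case True
    have "?D g = (\<Sum>a\<in>A. adj H K (v a) (w a g))" by (rule ext) (simp add: sum_apply)
    also have "\<dots> \<in> l2 H"
      by (rule l2_sum) (rule bop_l2[OF adj_bop[OF v] bop_l2[OF w True]])
    finally have Dg: "?D g \<in> l2 H" .
    show ?thesis
    proof
      fix i show "?D g i = (if P then idop H else 0) g i"
      proof (cases "i \<in> H")
        case i: True
        have "?D g i = l2_inner (ket i) (?D g)" by (simp only: l2_inner_ket)
        also have "\<dots> = (if P then g i else 0)"
          using sum_adj_comp_inner[of A v H K w "ket i" g, OF v w l2_ket[OF i] True] eq[OF i True] by simp
        finally show ?thesis using True by (simp add: idop_def)
      next
        case False
        then show ?thesis using l2_off[OF Dg False] l2_off[OF True False]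
          by (simp add: idop_def)
      qed
    qed
  next
    case False
    have "?D g = (\<Sum>a\<in>A. adj H K (v a) (w a g))" by (rule ext) (simp add: sum_apply)
    also have "\<dots> = (\<Sum>a\<in>A. adj H K (v a) 0)"
      by (rule sum.cong[OF refl]) (simp only: bop_off[OF w False])
    also have "\<dots> = 0" by (rule sum.neutral) (use bop_zero[OF adj_bop[OF v]] in blast)
    finally show ?thesis using False by (simp add: idop_def)
  qed
qed

lemma sum_adj_compD:
  assumes v: "\<And>a. a \<in> A \<Longrightarrow> v a \<in> bop H K" and w: "\<And>a. a \<in> A \<Longrightarrow> w a \<in> bop H K"
    and eq: "(\<Sum>a\<in>A. adj H K (v a) \<circ> w a) = (if P then idop H else 0)"
    and f: "f \<in> l2 H" and g: "g \<in> l2 H"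
  shows "(\<Sum>a\<in>A. l2_inner (v a f) (w a g)) = (if P then l2_inner f g else 0)"
proof -
  have "(\<Sum>a\<in>A. l2_inner (v a f) (w a g)) = l2_inner f ((\<Sum>a\<in>A. adj H K (v a) \<circ> w a) g)"
    by (rule sum_adj_comp_inner[OF v w f g, symmetric])
  then show ?thesis unfolding eq using g by (simp add: idop_def)
qed

lemma bi_isometryI:
  assumes op: "\<And>a x. block V a x \<in> bop (dom_ix V) (cod_ix V)"
    and rows: "\<And>x x' i g. i \<in> dom_ix V \<Longrightarrow> g \<in> l2 (dom_ix V) \<Longrightarrow>
      (\<Sum>a\<in>UNIV. l2_inner (block V a x (ket i)) (block V a x' g)) = (if x = x' then g i else 0)"
    and cols: "\<And>a a' i g. i \<in> dom_ix V \<Longrightarrow> g \<in> l2 (dom_ix V) \<Longrightarrow>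
      (\<Sum>x\<in>UNIV. l2_inner (block V a x (ket i)) (block V a' x g)) = (if a = a' then g i else 0)"
  shows "bi_isometry V"
  unfolding bi_isometry_def Let_def
proof (intro conjI allI)
  show "block V a x \<in> bop (dom_ix V) (cod_ix V)" for a x by (rule op)
  show "(\<Sum>a\<in>UNIV. adj (dom_ix V) (cod_ix V) (block V a x) \<circ> block V a x') =
      (if x = x' then idop (dom_ix V) else 0)" for x x'
    by (rule sum_adj_compI[OF op op rows])
  show "(\<Sum>x\<in>UNIV. adj (dom_ix V) (cod_ix V) (block V a x) \<circ> block V a' x) =
      (if a = a' then idop (dom_ix V) else 0)" for a a'
    by (rule sum_adj_compI[OF op op cols])
qed

lemma
  assumes "bi_isometry V"
  shows bi_isometry_bop: "block V a x \<in> bop (dom_ix V) (cod_ix V)"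
    and bi_isometry_rows: "f \<in> l2 (dom_ix V) \<Longrightarrow> g \<in> l2 (dom_ix V) \<Longrightarrow>
      (\<Sum>a\<in>UNIV. l2_inner (block V a x f) (block V a x' g)) = (if x = x' then l2_inner f g else 0)"
    and bi_isometry_cols: "f \<in> l2 (dom_ix V) \<Longrightarrow> g \<in> l2 (dom_ix V) \<Longrightarrow>
      (\<Sum>x\<in>UNIV. l2_inner (block V a x f) (block V a' x g)) = (if a = a' then l2_inner f g else 0)"
proof -
  have op: "block V a x \<in> bop (dom_ix V) (cod_ix V)" for a x
    using assms by (simp only: bi_isometry_def Let_def)
  have r: "(\<Sum>a\<in>UNIV. adj (dom_ix V) (cod_ix V) (block V a x) \<circ> block V a x') =
      (if x = x' then idop (dom_ix V) else 0)"
    using assms by (simp only: bi_isometry_def Let_def)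
  have c: "(\<Sum>x\<in>UNIV. adj (dom_ix V) (cod_ix V) (block V a x) \<circ> block V a' x) =
      (if a = a' then idop (dom_ix V) else 0)"
    using assms by (simp only: bi_isometry_def Let_def)
  show "block V a x \<in> bop (dom_ix V) (cod_ix V)" by (rule op)
  show "f \<in> l2 (dom_ix V) \<Longrightarrow> g \<in> l2 (dom_ix V) \<Longrightarrow>
      (\<Sum>a\<in>UNIV. l2_inner (block V a x f) (block V a x' g)) = (if x = x' then l2_inner f g else 0)"
    by (rule sum_adj_compD[OF op op r])
  show "f \<in> l2 (dom_ix V) \<Longrightarrow> g \<in> l2 (dom_ix V) \<Longrightarrow>
      (\<Sum>x\<in>UNIV. l2_inner (block V a x f) (block V a' x g)) = (if a = a' then l2_inner f g else 0)"
    by (rule sum_adj_compD[OF op op c])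
qed

text \<open>
  Each block is a contraction because \<open>\<Sum>\<^sub>a V\<^sub>a\<^sub>,\<^sub>x\<^sup>*V\<^sub>a\<^sub>,\<^sub>x\<close> is the identity. The bound is uniform in \<open>V\<close>,
  which is what makes the direct sum over all representatives bounded.
\<close>

lemma bi_isometry_contraction:
  assumes V: "bi_isometry V" and f: "f \<in> l2 (dom_ix V)"
  shows "l2_norm (block V a x f) \<le> l2_norm f"
proof -
  have "complex_of_real (\<Sum>a\<in>UNIV. (l2_norm (block V a x f))\<^sup>2) = of_real ((l2_norm f)\<^sup>2)"
    using bi_isometry_rows[OF V f f, of x x]
    unfolding l2_inner_self[OF f] l2_inner_self[OF bop_l2[OF bi_isometry_bop[OF V] f]] by simp
  then have "(\<Sum>a\<in>UNIV. (l2_norm (block V a x f))\<^sup>2) = (l2_norm f)\<^sup>2"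
    by (simp only: of_real_eq_iff)
  moreover have "(l2_norm (block V a x f))\<^sup>2 \<le> (\<Sum>a\<in>UNIV. (l2_norm (block V a x f))\<^sup>2)"
    by (rule member_le_sum) auto
  ultimately have "(l2_norm (block V a x f))\<^sup>2 \<le> (l2_norm f)\<^sup>2" by simp
  then show ?thesis by (rule power2_le_imp_le) simp
qed

section \<open>The universal bi-isometry\<close>

definition slice :: "'v \<Rightarrow> ('v \<times> 'i \<Rightarrow> complex) \<Rightarrow> 'i \<Rightarrow> complex"
  where "slice V f = (\<lambda>i. f (V, i))"

definition inject :: "'v \<Rightarrow> ('i \<Rightarrow> complex) \<Rightarrow> 'v \<times> 'i \<Rightarrow> complex"
  where "inject V f = (\<lambda>(W, i). if W = V then f i else 0)"

lemma slice_l2: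
  assumes f: "f \<in> l2 (Sigma R D)" and V: "V \<in> R"
  shows "slice V f \<in> l2 (D V)"
proof (rule l2_boundedI(1))
  show "slice V f i = 0" if "i \<notin> D V" for i
    using l2_off[OF f, of "(V, i)"] that by (simp add: slice_def)
  fix F :: "'b set" assume F: "finite F"
  have "(\<Sum>i\<in>F. (cmod (slice V f i))\<^sup>2) = (\<Sum>p\<in>Pair V ` F. (cmod (f p))\<^sup>2)"
    by (subst sum.reindex) (auto simp: inj_on_def slice_def)
  also have "\<dots> \<le> (l2_norm f)\<^sup>2" by (rule sum_le_l2_norm_sq[OF f]) (simp add: F)
  finally show "(\<Sum>i\<in>F. (cmod (slice V f i))\<^sup>2) \<le> (l2_norm f)\<^sup>2" .
qed simp

lemma sum_slices_le:
  assumes f: "f \<in> l2 S" and G: "finite G"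
  shows "(\<Sum>V\<in>G. (l2_norm (slice V f))\<^sup>2) \<le> (l2_norm f)\<^sup>2"
proof -
  have sm: "(\<lambda>p. (cmod (f p))\<^sup>2) summable_on (Sigma G (\<lambda>_. UNIV))"
    by (rule summable_on_subset_banach[OF l2_summable[OF f]]) simp
  have "(\<Sum>V\<in>G. (l2_norm (slice V f))\<^sup>2) = (\<Sum>\<^sub>\<infinity>V\<in>G. \<Sum>\<^sub>\<infinity>i. (cmod (f (V, i)))\<^sup>2)"
    using G by (simp add: l2_norm_sq slice_def)
  also have "\<dots> = (\<Sum>\<^sub>\<infinity>p\<in>Sigma G (\<lambda>_. UNIV). (cmod (f p))\<^sup>2)"
    using infsum_Sigma'_banach[of "\<lambda>V i. (cmod (f (V, i)))\<^sup>2" G "\<lambda>_. UNIV"] sm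
    by (simp add: case_prod_unfold)
  also have "\<dots> \<le> (l2_norm f)\<^sup>2"
    unfolding l2_norm_sq by (rule infsum_mono2[OF sm l2_summable[OF f]]) auto
  finally show ?thesis .
qed

lemma inject_l2:
  assumes f: "f \<in> l2 (D V)" and V: "V \<in> R"
  shows "inject V f \<in> l2 (Sigma R D)"
proof (rule l2_boundedI(1))
  show "inject V f p = 0" if "p \<notin> Sigma R D" for p
    using l2_off[OF f] that V by (auto simp: inject_def split: prod.split)
  fix F :: "('b \<times> 'a) set" assume F: "finite F"
  have "(\<Sum>p\<in>F. (cmod (inject V f p))\<^sup>2) = (\<Sum>p\<in>F \<inter> Pair V ` UNIV. (cmod (inject V f p))\<^sup>2)"
    by (rule sum.mono_neutral_right) (auto simp: F inject_def split: if_splits)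
  also have "\<dots> = (\<Sum>i\<in>Pair V -` F. (cmod (f i))\<^sup>2)"
    by (rule sum.reindex_cong[of "Pair V"]) (auto simp: inj_on_def inject_def)
  also have "\<dots> \<le> (l2_norm f)\<^sup>2"
    by (rule sum_le_l2_norm_sq[OF f]) (intro finite_vimageI F, simp add: inj_on_def)
  finally show "(\<Sum>p\<in>F. (cmod (inject V f p))\<^sup>2) \<le> (l2_norm f)\<^sup>2" .
qed simp

lemma l2_inner_inject: "l2_inner (inject V f) h = l2_inner f (slice V h)"
proof -
  have "l2_inner (inject V f) h = (\<Sum>\<^sub>\<infinity>p\<in>Pair V ` UNIV. cnj (inject V f p) * h p)"
    unfolding l2_inner_def by (rule infsum_cong_neutral) (auto simp: inject_def)
  also have "\<dots> = l2_inner f (slice V h)"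
    unfolding l2_inner_def by (subst infsum_reindex) (auto simp: inj_on_def inject_def slice_def o_def)
  finally show ?thesis .
qed

lemma ket_pair: "ket (V, i) = inject V (ket i)"
  by (auto simp: ket_def inject_def fun_eq_iff)

lemma slice_inject: "slice V (inject V f) = f"
  by (simp add: slice_def inject_def)

lemma slice_inject_other: "W \<noteq> V \<Longrightarrow> slice W (inject V f) = 0"
  by (simp add: slice_def inject_def fun_eq_iff)

lemma univ_v_apply:
  "f \<in> l2 (univ_dom R) \<Longrightarrow> univ_v R a x f (V, k) = (if V \<in> R then block V a x (slice V f) k else 0)"
  by (simp add: univ_v_def slice_def)

text \<open>
  A finite set of coordinates meets only finitely many summands, and on each summand the operator is a
  contraction; hence so is the direct sum.
\<close>

lemma univ_v_bop:
  assumes R: "\<forall>V\<in>R. bi_isometry V"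
  shows "univ_v R a x \<in> bop (univ_dom R) (univ_cod R)"
proof -
  have op: "block V a x \<in> bop (dom_ix V) (cod_ix V)" if "V \<in> R" for V
    using R that by (blast intro: bi_isometry_bop)
  have bd: "univ_v R a x f \<in> l2 (univ_cod R)" "l2_norm (univ_v R a x f) \<le> l2_norm f"
    if f: "f \<in> l2 (univ_dom R)" for f
  proof -
    have off: "univ_v R a x f p = 0" if "p \<notin> univ_cod R" for p
    proof (cases p)
      case (Pair V k)
      then show ?thesis
        using that l2_off[OF bop_l2[OF op slice_l2[OF f]], of V k] by (auto simp: univ_v_apply[OF f])
    qed
    have fin: "(\<Sum>p\<in>F. (cmod (univ_v R a x f p))\<^sup>2) \<le> (l2_norm f)\<^sup>2" if F: "finite F" for F
    proof -
      have "(\<Sum>p\<in>F. (cmod (univ_v R a x f p))\<^sup>2)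
          \<le> (\<Sum>p\<in>fst ` F \<times> snd ` F. (cmod (univ_v R a x f p))\<^sup>2)"
        by (rule sum_mono2) (use F in \<open>auto intro: rev_image_eqI\<close>)
      also have "\<dots> = (\<Sum>V\<in>fst ` F. \<Sum>k\<in>snd ` F. (cmod (univ_v R a x f (V, k)))\<^sup>2)"
        by (simp add: sum.cartesian_product)
      also have "\<dots> \<le> (\<Sum>V\<in>fst ` F. (l2_norm (slice V f))\<^sup>2)"
      proof (rule sum_mono)
        fix V
        show "(\<Sum>k\<in>snd ` F. (cmod (univ_v R a x f (V, k)))\<^sup>2) \<le> (l2_norm (slice V f))\<^sup>2"
        proof (cases "V \<in> R")
          case True
          note s = slice_l2[OF f True]
          have "(\<Sum>k\<in>snd ` F. (cmod (block V a x (slice V f) k))\<^sup>2) \<le> (l2_norm (block V a x (slice V f)))\<^sup>2"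
            by (rule sum_le_l2_norm_sq[OF bop_l2[OF op[OF True] s]]) (simp add: F)
          also have "\<dots> \<le> (l2_norm (slice V f))\<^sup>2"
            using bi_isometry_contraction[OF bspec[OF R True] s] by (intro power_mono) auto
          finally show ?thesis using True by (simp add: univ_v_apply[OF f])
        qed (simp add: univ_v_apply[OF f])
      qed
      also have "\<dots> \<le> (l2_norm f)\<^sup>2" by (rule sum_slices_le[OF f]) (simp add: F)
      finally show ?thesis .
    qed
    show "univ_v R a x f \<in> l2 (univ_cod R)" "l2_norm (univ_v R a x f) \<le> l2_norm f"
      using l2_boundedI[OF off fin l2_norm_nonneg] by blast+
  qed
  show ?thesis
  proof (rule bopI[where c = 1])
    fix f g assume f: "f \<in> l2 (univ_dom R)" and g: "g \<in> l2 (univ_dom R)"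
    show "univ_v R a x (f + g) = univ_v R a x f + univ_v R a x g"
    proof
      fix p show "univ_v R a x (f + g) p = (univ_v R a x f + univ_v R a x g) p"
      proof (cases p)
        case (Pair V k)
        have "slice V (f + g) = slice V f + slice V g" by (simp add: slice_def fun_eq_iff)
        then show ?thesis
          using Pair bop_add[OF op slice_l2[OF f] slice_l2[OF g]]
          by (simp add: univ_v_apply[OF f] univ_v_apply[OF g] univ_v_apply[OF l2_add[OF f g]])
      qed
    qed
  next
    fix c f assume f: "f \<in> l2 (univ_dom R)"
    show "univ_v R a x (c *\<^sub>C f) = c *\<^sub>C univ_v R a x f"
    proof
      fix p show "univ_v R a x (c *\<^sub>C f) p = (c *\<^sub>C univ_v R a x f) p"
      proof (cases p)
        case (Pair V k)
        have "slice V (c *\<^sub>C f) = c *\<^sub>C slice V f" by (simp add: slice_def fun_eq_iff)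
        then show ?thesis
          using Pair bop_scale[OF op slice_l2[OF f], of V c]
          by (simp add: univ_v_apply[OF f] univ_v_apply[OF l2_scale[OF f]])
      qed
    qed
  qed (use bd in \<open>simp_all add: univ_v_def\<close>)
qed

text \<open>
  All other summands of the image vanish since the blocks are linear. Matrix elements at a vector lying in
  one summand are therefore those of a single bi-isometry.
\<close>

lemma univ_v_inject:
  assumes R: "\<forall>V\<in>R. bi_isometry V" and V: "V \<in> R" and f: "f \<in> l2 (dom_ix V)"
  shows "univ_v R a x (inject V f) = inject V (block V a x f)"
proof
  fix p
  note e = inject_l2[where D = dom_ix, OF f V]
  show "univ_v R a x (inject V f) p = inject V (block V a x f) p"
  proof (cases p)
    case (Pair W k)
    show ?thesis
    proof (cases "W = V")
      case True
      then show ?thesis using V Pair by (simp add: univ_v_apply[OF e] slice_inject) (simp add: inject_def)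
    next
      case False
      have "W \<in> R \<Longrightarrow> block W a x 0 = 0"
        using R bi_isometry_bop bop_zero by blast
      then show ?thesis using False Pair
        by (simp add: univ_v_apply[OF e] slice_inject_other) (simp add: inject_def)
    qed
  qed
qed

lemma slice_univ_v:
  "V \<in> R \<Longrightarrow> f \<in> l2 (univ_dom R) \<Longrightarrow> slice V (univ_v R a x f) = block V a x (slice V f)"
  by (simp add: slice_def univ_v_apply fun_eq_iff)

lemma univ_e_bop:
  "\<forall>V\<in>R. bi_isometry V \<Longrightarrow> univ_e R x x' a a' \<in> bop (univ_dom R) (univ_dom R)"
  unfolding univ_e_def by (rule bop_comp[OF univ_v_bop adj_bop[OF univ_v_bop]])

lemma univ_e_inner:
  assumes "\<forall>V\<in>R. bi_isometry V" "f \<in> l2 (univ_dom R)" "g \<in> l2 (univ_dom R)"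
  shows "l2_inner f (univ_e R x x' a a' g) = l2_inner (univ_v R a x f) (univ_v R a' x' g)"
  unfolding univ_e_def o_apply
  by (rule adj_inner[OF univ_v_bop[OF assms(1)] assms(2) bop_l2[OF univ_v_bop[OF assms(1)] assms(3)]])

text \<open>The direct sum of bi-isometries is a bi-isometry, since a basis vector lies in one summand.\<close>

lemma
  assumes R: "\<forall>V\<in>R. bi_isometry V"
  shows univ_e_rows: "(\<Sum>a\<in>UNIV. univ_e R x x' a a) = (if x = x' then idop (univ_dom R) else 0)"
    and univ_e_cols: "(\<Sum>x\<in>UNIV. univ_e R x x a a') = (if a = a' then idop (univ_dom R) else 0)"
proof -
  note op = univ_v_bop[OF R]
  have red: "l2_inner (univ_v R a x (ket p)) (univ_v R a' x' g) =
      l2_inner (block V a x (ket k)) (block V a' x' (slice V g))"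
    if p: "p = (V, k)" "V \<in> R" "k \<in> dom_ix V" and g: "g \<in> l2 (univ_dom R)" for p V k g a a' x x'
    unfolding p(1) ket_pair univ_v_inject[OF R p(2) l2_ket[OF p(3)]] l2_inner_inject
      slice_univ_v[OF p(2) g] ..
  show "(\<Sum>a\<in>UNIV. univ_e R x x' a a) = (if x = x' then idop (univ_dom R) else 0)"
    unfolding univ_e_def
  proof (rule sum_adj_compI[OF op op])
    fix p g assume p: "p \<in> univ_dom R" and g: "g \<in> l2 (univ_dom R)"
    then obtain V k where Vk: "p = (V, k)" "V \<in> R" "k \<in> dom_ix V" by auto
    show "(\<Sum>a\<in>UNIV. l2_inner (univ_v R a x (ket p)) (univ_v R a x' g)) = (if x = x' then g p else 0)"
      unfolding red[OF Vk g]
        bi_isometry_rows[OF bspec[OF R Vk(2)] l2_ket[OF Vk(3)] slice_l2[OF g Vk(2)]] l2_inner_ket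
      by (simp add: slice_def Vk(1))
  qed
  show "(\<Sum>x\<in>UNIV. univ_e R x x a a') = (if a = a' then idop (univ_dom R) else 0)"
    unfolding univ_e_def
  proof (rule sum_adj_compI[OF op op])
    fix p g assume p: "p \<in> univ_dom R" and g: "g \<in> l2 (univ_dom R)"
    then obtain V k where Vk: "p = (V, k)" "V \<in> R" "k \<in> dom_ix V" by auto
    show "(\<Sum>x\<in>UNIV. l2_inner (univ_v R a x (ket p)) (univ_v R a' x g)) = (if a = a' then g p else 0)"
      unfolding red[OF Vk g]
        bi_isometry_cols[OF bspec[OF R Vk(2)] l2_ket[OF Vk(3)] slice_l2[OF g Vk(2)]] l2_inner_ket
      by (simp add: slice_def Vk(1))
  qed
qed

section \<open>Gram vectors of positive kernels\<close>

definition psd_on :: "'p set \<Rightarrow> ('p \<Rightarrow> 'p \<Rightarrow> complex) \<Rightarrow> bool"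
  where "psd_on P C \<longleftrightarrow> (\<forall>\<xi>. (\<Sum>p\<in>P. \<Sum>q\<in>P. cnj (\<xi> p) * C p q * \<xi> q) \<in> \<real>\<^sub>\<ge>\<^sub>0)"

lemma psd_on_subset:
  assumes "psd_on P C" "finite P" "Q \<subseteq> P"
  shows "psd_on Q C"
  unfolding psd_on_def
proof
  fix \<xi> :: "'a \<Rightarrow> complex"
  define \<zeta> where "\<zeta> = (\<lambda>p. if p \<in> Q then \<xi> p else 0)"
  have "(\<Sum>p\<in>P. \<Sum>q\<in>P. cnj (\<zeta> p) * C p q * \<zeta> q) = (\<Sum>p\<in>Q. \<Sum>q\<in>P. cnj (\<zeta> p) * C p q * \<zeta> q)"
    by (rule sum.mono_neutral_right) (use assms in \<open>auto simp: \<zeta>_def\<close>)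
  also have "\<dots> = (\<Sum>p\<in>Q. \<Sum>q\<in>Q. cnj (\<zeta> p) * C p q * \<zeta> q)"
    by (rule sum.cong[OF refl], rule sum.mono_neutral_right) (use assms in \<open>auto simp: \<zeta>_def\<close>)
  also have "\<dots> = (\<Sum>p\<in>Q. \<Sum>q\<in>Q. cnj (\<xi> p) * C p q * \<xi> q)"
    by (intro sum.cong refl) (simp add: \<zeta>_def)
  finally show "(\<Sum>p\<in>Q. \<Sum>q\<in>Q. cnj (\<xi> p) * C p q * \<xi> q) \<in> \<real>\<^sub>\<ge>\<^sub>0"
    using assms(1)[unfolded psd_on_def, rule_format, of \<zeta>] by (simp only:)
qed

lemma psd_on_diag:
  assumes "psd_on P C" "finite P" "p \<in> P"
  shows "C p p \<in> \<real>\<^sub>\<ge>\<^sub>0"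
proof -
  have "psd_on {p} C" using assms by (intro psd_on_subset[OF assms(1,2)]) simp
  from this[unfolded psd_on_def, rule_format, of "\<lambda>_. 1"] show ?thesis by simp
qed

lemma psd_on_pair:
  assumes "psd_on P C" "finite P" "p \<in> P" "q \<in> P" "p \<noteq> q"
  shows "cnj \<alpha> * C p p * \<alpha> + cnj \<alpha> * C p q * \<beta> + cnj \<beta> * C q p * \<alpha> + cnj \<beta> * C q q * \<beta> \<in> \<real>\<^sub>\<ge>\<^sub>0"
proof -
  have "psd_on {p, q} C" using assms by (intro psd_on_subset[OF assms(1,2)]) simp
  from this[unfolded psd_on_def, rule_format, of "\<lambda>r. if r = p then \<alpha> else \<beta>"] assms(5)
  show ?thesis by (simp add: add_ac)
qed

lemma psd_on_hermitian:
  assumes "psd_on P C" "finite P" "p \<in> P" "q \<in> P"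
  shows "C q p = cnj (C p q)"
proof (cases "p = q")
  case True
  then show ?thesis using psd_on_diag[OF assms(1-3)] by (simp add: complex_nonneg_Reals_iff complex_eq_iff)
next
  case False
  note d = psd_on_diag[OF assms(1-3)] psd_on_diag[OF assms(1,2,4)]
  have "Im (C p q) + Im (C q p) = 0" "Re (C p q) - Re (C q p) = 0"
    using psd_on_pair[OF assms False, of 1 1] psd_on_pair[OF assms False, of 1 \<i>] d
    by (auto simp: complex_nonneg_Reals_iff)
  then show ?thesis by (simp add: complex_eq_iff)
qed

text \<open>
  On the span of \<open>p\<close> and \<open>q\<close> the quadratic form is affine along \<open>p\<close>. It can only be bounded below if the
  linear coefficient vanishes.
\<close>

lemma psd_on_zero_diag:
  assumes "psd_on P C" "finite P" "p \<in> P" "q \<in> P" "C p p = 0"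
  shows "C p q = 0"
proof (cases "p = q")
  case False
  have herm: "C q p = cnj (C p q)" by (rule psd_on_hermitian[OF assms(1-4)])
  have le: "2 * t * (cmod (C p q))\<^sup>2 \<le> Re (C q q)" for t :: real
  proof -
    have "cnj (- of_real t * C p q) * C p q + C q p * (- of_real t * C p q) + C q q \<in> \<real>\<^sub>\<ge>\<^sub>0"
      using psd_on_pair[OF assms(1-4) False, of "- of_real t * C p q" 1] assms(5) by simp
    moreover have "cnj (- of_real t * C p q) * C p q + C q p * (- of_real t * C p q) + C q q
        = C q q - of_real (2 * t) * (cnj (C p q) * C p q)"
      by (simp add: herm algebra_simps)
    ultimately have "C q q - of_real (2 * t * (cmod (C p q))\<^sup>2) \<in> \<real>\<^sub>\<ge>\<^sub>0"
      by (simp only: cnj_mult_self of_real_mult)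
    then have "0 \<le> Re (C q q) - 2 * t * (cmod (C p q))\<^sup>2"
      by (simp only: complex_nonneg_Reals_iff minus_complex.sel Re_complex_of_real)
    then show ?thesis by linarith
  qed
  show ?thesis
  proof (rule ccontr)
    assume "C p q \<noteq> 0"
    then have pos: "0 < (cmod (C p q))\<^sup>2" by simp
    have "2 * ((Re (C q q) + 1) / (cmod (C p q))\<^sup>2) * (cmod (C p q))\<^sup>2 = 2 * (Re (C q q) + 1)"
      using pos by simp
    moreover have "0 \<le> Re (C q q)"
      using psd_on_diag[OF assms(1,2,4)] by (simp add: complex_nonneg_Reals_iff)
    ultimately show False using le[of "(Re (C q q) + 1) / (cmod (C p q))\<^sup>2"] by simp
  qed
qed (use assms in simp)

text \<open>
  The form of the Schur complement is the minimum of the original form over the coordinate \<open>p\<close>, attained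
  at the value \<open>z\<close> below; hence it stays positive.
\<close>

lemma psd_on_Schur_complement:
  assumes psd: "psd_on (insert p P) C" and P: "finite P" "p \<notin> P" and c: "C p p \<noteq> 0"
  shows "psd_on P (\<lambda>q q'. C q q' - C q p * C p q' / C p p)"
  unfolding psd_on_def
proof
  fix \<xi> :: "'a \<Rightarrow> complex"
  define L where "L = (\<Sum>q\<in>P. C p q * \<xi> q)"
  define M where "M = (\<Sum>q\<in>P. cnj (\<xi> q) * C q p)"
  define F where "F = (\<Sum>q\<in>P. \<Sum>q'\<in>P. cnj (\<xi> q) * C q q' * \<xi> q')"
  define z where "z = - L / C p p"
  define \<zeta> where "\<zeta> = \<xi>(p := z)"
  have \<zeta>: "\<zeta> p = z" "q \<in> P \<Longrightarrow> \<zeta> q = \<xi> q" for q using P by (auto simp: \<zeta>_def)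
  have "(\<Sum>q\<in>insert p P. \<Sum>q'\<in>insert p P. cnj (\<zeta> q) * C q q' * \<zeta> q')
      = cnj z * C p p * z + (\<Sum>q'\<in>P. cnj z * C p q' * \<xi> q')
        + ((\<Sum>q\<in>P. cnj (\<xi> q) * C q p * z) + F)"
    using P by (simp add: \<zeta> F_def sum.distrib cong: sum.cong)
  also have "(\<Sum>q'\<in>P. cnj z * C p q' * \<xi> q') = cnj z * L"
    by (simp add: L_def sum_distrib_left mult_ac)
  also have "(\<Sum>q\<in>P. cnj (\<xi> q) * C q p * z) = M * z"
    by (simp add: M_def sum_distrib_right)
  also have "cnj z * C p p * z + cnj z * L + (M * z + F) = F - M * L / C p p"
    using c by (simp add: z_def field_simps)
  also have "\<dots> = (\<Sum>q\<in>P. \<Sum>q'\<in>P. cnj (\<xi> q) * (C q q' - C q p * C p q' / C p p) * \<xi> q')"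
  proof -
    have "M * L / C p p = (\<Sum>q\<in>P. \<Sum>q'\<in>P. cnj (\<xi> q) * (C q p * C p q' / C p p) * \<xi> q')"
      unfolding M_def L_def sum_product sum_divide_distrib by (simp add: mult_ac)
    then show ?thesis
      by (simp add: F_def right_diff_distrib left_diff_distrib sum_subtractf)
  qed
  finally show "(\<Sum>q\<in>P. \<Sum>q'\<in>P. cnj (\<xi> q) * (C q q' - C q p * C p q' / C p p) * \<xi> q') \<in> \<real>\<^sub>\<ge>\<^sub>0"
    using psd[unfolded psd_on_def, rule_format, of \<zeta>] by (simp only:)
qed

text \<open>
  This is a Cholesky decomposition, one point of the kernel at a time. A point on which the form vanishes
  contributes the zero vector; any other point contributes a new dimension and leaves the Schur complement
  to be decomposed. The coefficients \<open>\<alpha>\<close> express the basis vectors through the family, so that a linear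
  map on \<open>\<ell>\<^sup>2(S)\<close> can be prescribed by its values on the family.
\<close>

lemma Gram_spanning_family:
  assumes inf: "infinite (UNIV :: 'i set)" and "finite P" "psd_on P C"
  shows "\<exists>(S :: 'i set) b \<alpha>. finite S \<and> (\<forall>p. \<forall>i. i \<notin> S \<longrightarrow> b p i = 0) \<and>
    (\<forall>p\<in>P. \<forall>q\<in>P. (\<Sum>i\<in>S. cnj (b p i) * b q i) = C p q) \<and>
    (\<forall>i\<in>S. \<forall>j. (\<Sum>p\<in>P. \<alpha> i p * b p j) = ket i j)"
  using assms(2,3)
proof (induction P arbitrary: C rule: finite_induct)
  case empty
  show ?case by (rule exI[of _ "{}"], rule exI[of _ "\<lambda>_ _. 0"]) simp
next
  case (insert p P)
  note psd = insert.prems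
  have fin: "finite (insert p P)" using insert.hyps by simp
  have herm: "C q' q = cnj (C q q')" if "q \<in> insert p P" "q' \<in> insert p P" for q q'
    by (rule psd_on_hermitian[OF psd fin that])
  show ?case
  proof (cases "C p p = 0")
    case True
    have z: "C p q = 0" "C q p = 0" if "q \<in> insert p P" for q
      using psd_on_zero_diag[OF psd fin _ that True] herm[of p q] that by simp_all
    obtain S :: "'i set" and b \<alpha> where S: "finite S" "\<forall>p. \<forall>i. i \<notin> S \<longrightarrow> b p i = 0"
      and G: "\<forall>p\<in>P. \<forall>q\<in>P. (\<Sum>i\<in>S. cnj (b p i) * b q i) = C p q"
      and sp: "\<forall>i\<in>S. \<forall>j. (\<Sum>p\<in>P. \<alpha> i p * b p j) = ket i j"
      using insert.IH[OF psd_on_subset[OF psd fin subset_insertI]] by blast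
    define b' where "b' = b(p := \<lambda>_. 0)"
    have b': "b' p i = 0" "q \<in> P \<Longrightarrow> b' q i = b q i" for q i
      using insert.hyps by (auto simp: b'_def)
    have "\<forall>q. \<forall>i. i \<notin> S \<longrightarrow> b' q i = 0" using S by (simp add: b'_def)
    moreover have "\<forall>q\<in>insert p P. \<forall>q'\<in>insert p P. (\<Sum>i\<in>S. cnj (b' q i) * b' q' i) = C q q'"
      using G z True by (simp add: b')
    moreover have "\<forall>i\<in>S. \<forall>j. (\<Sum>q\<in>insert p P. \<alpha> i q * b' q j) = ket i j"
      using sp insert.hyps by (simp add: b' cong: sum.cong)
    ultimately show ?thesis using S(1) by blast
  next
    case False
    define r where "r = complex_of_real (sqrt (Re (C p p)))"
    have cpos: "0 \<le> Re (C p p)" "Im (C p p) = 0"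
      using psd_on_diag[OF psd fin, of p] by (simp_all add: complex_nonneg_Reals_iff)
    have rr: "r * r = C p p"
      using cpos by (simp add: r_def complex_eq_iff flip: of_real_mult)
    have r0: "r \<noteq> 0" using rr False by auto
    have cr: "cnj r = r" by (simp add: r_def)
    obtain S :: "'i set" and b \<alpha> where S: "finite S" and off: "\<forall>p. \<forall>i. i \<notin> S \<longrightarrow> b p i = 0"
      and G: "\<forall>q\<in>P. \<forall>q'\<in>P. (\<Sum>i\<in>S. cnj (b q i) * b q' i) = C q q' - C q p * C p q' / C p p"
      and sp: "\<forall>i\<in>S. \<forall>j. (\<Sum>q\<in>P. \<alpha> i q * b q j) = ket i j"
      using insert.IH[OF psd_on_Schur_complement[OF psd insert.hyps False]] by blast
    obtain s where s: "s \<notin> S" using ex_new_if_finite[OF inf S] by blast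
    \<comment> \<open>One new dimension \<open>s\<close> carries the component along \<open>p\<close>.\<close>
    define b' where "b' = (\<lambda>q i. if i = s then C p q / r else if q = p then 0 else b q i)"
    define \<alpha>' where "\<alpha>' = (\<lambda>i q. if i = s then (if q = p then 1 / r else 0)
      else if q = p then - (\<Sum>q\<in>P. \<alpha> i q * C p q) / C p p else \<alpha> i q)"
    have pr: "C p p / r = r" using rr r0 by (simp add: field_simps)
    have neq: "q \<noteq> p" if "q \<in> P" for q using insert.hyps that by blast
    have b's: "b' q s = C p q / r" for q by (simp add: b'_def)
    have b'S: "b' q i = (if q = p then 0 else b q i)" if "i \<in> S" for q i
      using that s by (auto simp: b'_def)
    have "\<forall>q. \<forall>i. i \<notin> insert s S \<longrightarrow> b' q i = 0" using off by (simp add: b'_def)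
    moreover have "\<forall>q\<in>insert p P. \<forall>q'\<in>insert p P. (\<Sum>i\<in>insert s S. cnj (b' q i) * b' q' i) = C q q'"
    proof (intro ballI)
      fix q q' assume q: "q \<in> insert p P" and q': "q' \<in> insert p P"
      have "(\<Sum>i\<in>insert s S. cnj (b' q i) * b' q' i)
          = cnj (C p q / r) * (C p q' / r) + (\<Sum>i\<in>S. cnj (b' q i) * b' q' i)"
        using S s by (simp add: b's)
      also have "cnj (C p q / r) * (C p q' / r) = C q p * C p q' / C p p"
        using herm[OF _ q, of p] by (simp add: cr rr)
      also have "(\<Sum>i\<in>S. cnj (b' q i) * b' q' i) = C q q' - C q p * C p q' / C p p"
      proof (cases "q = p \<or> q' = p")
        case True
        then have "(\<Sum>i\<in>S. cnj (b' q i) * b' q' i) = 0"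
          by (intro sum.neutral) (auto simp: b'S)
        then show ?thesis using True False by auto
      next
        case F: False
        then have "(\<Sum>i\<in>S. cnj (b' q i) * b' q' i) = (\<Sum>i\<in>S. cnj (b q i) * b q' i)"
          by (intro sum.cong) (auto simp: b'S)
        then show ?thesis using G q q' F by simp
      qed
      finally show "(\<Sum>i\<in>insert s S. cnj (b' q i) * b' q' i) = C q q'" by simp
    qed
    moreover have "\<forall>i\<in>insert s S. \<forall>j. (\<Sum>q\<in>insert p P. \<alpha>' i q * b' q j) = ket i j"
    proof (intro ballI allI)
      fix i j assume i: "i \<in> insert s S"
      have split: "(\<Sum>q\<in>insert p P. \<alpha>' i q * b' q j) = \<alpha>' i p * b' p j + (\<Sum>q\<in>P. \<alpha>' i q * b' q j)"
        using insert.hyps by simp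
      show "(\<Sum>q\<in>insert p P. \<alpha>' i q * b' q j) = ket i j"
      proof (cases "i = s")
        case True
        then have "(\<Sum>q\<in>P. \<alpha>' i q * b' q j) = 0"
          by (intro sum.neutral) (auto simp: \<alpha>'_def neq)
        then show ?thesis using True r0 rr
          unfolding split by (simp add: \<alpha>'_def b'_def ket_def pr)
      next
        case ne: False
        then have iS: "i \<in> S" using i ne by simp
        have "(\<Sum>q\<in>P. \<alpha>' i q * b' q j) = (\<Sum>q\<in>P. \<alpha> i q * b' q j)"
          by (rule sum.cong) (use ne neq in \<open>auto simp: \<alpha>'_def\<close>)
        also have "\<dots> = (if j = s then (\<Sum>q\<in>P. \<alpha> i q * C p q) / r else ket i j)"
        proof (cases "j = s")
          case True
          then show ?thesis by (simp add: b's sum_divide_distrib)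
        next
          case False
          have "(\<Sum>q\<in>P. \<alpha> i q * b' q j) = (\<Sum>q\<in>P. \<alpha> i q * b q j)"
            by (rule sum.cong) (use False neq in \<open>auto simp: b'_def\<close>)
          then show ?thesis using sp iS False by simp
        qed
        finally show ?thesis using ne False r0
          unfolding split by (auto simp: \<alpha>'_def b'_def ket_def)
      qed
    qed
    ultimately show ?thesis using S by blast
  qed
qed

section \<open>Bi-isometries with prescribed matrix elements\<close>

lemma l2_eq_0I:
  assumes f: "f \<in> l2 S" and z: "l2_inner f f = 0"
  shows "f = 0"
proof
  fix i
  have "(l2_norm f)\<^sup>2 = 0" using z by (simp only: l2_inner_self[OF f] of_real_eq_0_iff)
  then show "f i = 0 i" using sum_le_l2_norm_sq[OF f, of "{i}"] by simp
qed

lemma l2_inner_combinations: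
  assumes "\<And>i. i \<in> I \<Longrightarrow> f i \<in> l2 S" "\<And>j. j \<in> J \<Longrightarrow> g j \<in> l2 T"
  shows "l2_inner (\<Sum>i\<in>I. \<xi> i *\<^sub>C f i) (\<Sum>j\<in>J. \<zeta> j *\<^sub>C g j) =
    (\<Sum>i\<in>I. \<Sum>j\<in>J. cnj (\<xi> i) * l2_inner (f i) (g j) * \<zeta> j)"
proof -
  have G: "(\<Sum>j\<in>J. \<zeta> j *\<^sub>C g j) \<in> l2 T" by (rule l2_sum) (rule l2_scale[OF assms(2)])
  have "l2_inner (\<Sum>i\<in>I. \<xi> i *\<^sub>C f i) (\<Sum>j\<in>J. \<zeta> j *\<^sub>C g j) =
      (\<Sum>i\<in>I. l2_inner (\<xi> i *\<^sub>C f i) (\<Sum>j\<in>J. \<zeta> j *\<^sub>C g j))"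
    by (rule l2_inner_sum_left[OF G l2_scale[OF assms(1)]])
  also have "\<dots> = (\<Sum>i\<in>I. \<Sum>j\<in>J. l2_inner (\<xi> i *\<^sub>C f i) (\<zeta> j *\<^sub>C g j))"
    by (rule sum.cong[OF refl], rule l2_inner_sum_right[OF l2_scale[OF assms(1)] l2_scale[OF assms(2)]])
  finally show ?thesis by (simp only: l2_inner_scale_left l2_inner_scale_right mult_ac)
qed

definition marginals :: "('x::finite \<Rightarrow> 'x \<Rightarrow> 'x \<Rightarrow> 'x \<Rightarrow> complex) \<Rightarrow> complex \<Rightarrow> bool"
  where "marginals l c \<longleftrightarrow>
    (\<forall>x x'. (\<Sum>b\<in>UNIV. l x x' b b) = (if x = x' then c else 0)) \<and>
    (\<forall>a a'. (\<Sum>y\<in>UNIV. l y y a a') = (if a = a' then c else 0))"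

text \<open>
  With \<open>W\<^sub>a\<^sub>,\<^sub>x\<close> sending \<open>\<xi>\<close> to \<open>\<Sum>\<^sub>i \<xi>\<^sub>i w\<^sub>i\<^sub>,\<^sub>x\<^sub>,\<^sub>a\<close>, the marginal conditions express the sums
  \<open>\<Sum>\<^sub>a \<langle>W\<^sub>a\<^sub>,\<^sub>x \<xi>, W\<^sub>a\<^sub>,\<^sub>x\<^sub>' \<zeta>\<rangle>\<close> and \<open>\<Sum>\<^sub>x \<langle>W\<^sub>a\<^sub>,\<^sub>x \<xi>, W\<^sub>a\<^sub>'\<^sub>,\<^sub>x \<zeta>\<rangle>\<close> through the sesquilinear form of \<open>c\<close>, and this form is the
  inner product of \<open>\<Sum>\<^sub>i \<xi>\<^sub>i b\<^sub>i\<close> and \<open>\<Sum>\<^sub>i \<zeta>\<^sub>i b\<^sub>i\<close>. So \<open>W\<close> factors through the span of the \<open>b\<^sub>i\<close>, and the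
  factor is a bi-isometry.
\<close>

lemma bi_isometry_realising_kernel:
  fixes l :: "nat \<Rightarrow> nat \<Rightarrow> 'x::finite \<Rightarrow> 'x \<Rightarrow> 'x \<Rightarrow> 'x \<Rightarrow> complex"
  assumes inf: "infinite (UNIV :: 'i set)"
    and marg: "\<And>i j. i < n \<Longrightarrow> j < n \<Longrightarrow> marginals (l i j) (c i j)"
    and psd: "psd_on ({..<n} \<times> UNIV) (\<lambda>(i, x, a) (j, x', a'). l i j x x' a a')"
  shows "\<exists>(V :: ('i, 'x) block_op) b. bi_isometry V \<and> (\<forall>j. b j \<in> l2 (dom_ix V)) \<and>
    (\<forall>i<n. \<forall>j<n. \<forall>x x' a a'. l2_inner (block V a x (b i)) (block V a' x' (b j)) = l i j x x' a a')"
proof -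
  have rows: "(\<Sum>b\<in>UNIV. l i j x x' b b) = (if x = x' then c i j else 0)"
    and cols: "(\<Sum>y\<in>UNIV. l i j y y a a') = (if a = a' then c i j else 0)"
    if "i < n" "j < n" for i j x x' a a'
    using marg[OF that] by (simp_all only: marginals_def)
  obtain T :: "'i set" and w where T: "finite T" and w_off: "\<And>p i. i \<notin> T \<Longrightarrow> w p i = 0"
    and w: "\<And>p q. p \<in> {..<n} \<times> UNIV \<Longrightarrow> q \<in> {..<n} \<times> UNIV \<Longrightarrow> (\<Sum>i\<in>T. cnj (w p i) * w q i) =
      (case p of (i, x, a) \<Rightarrow> \<lambda>(j, x', a'). l i j x x' a a') q"
    using Gram_spanning_family[OF inf finite_cartesian_product[OF finite_lessThan finite] psd] by blast
  have w_l2: "w p \<in> l2 T" for p by (rule l2_finite_support[OF T]) (use w_off in auto)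
  have w_inner: "l2_inner (w (i, x, a)) (w (j, x', a')) = l i j x x' a a'" if "i < n" "j < n" for i j x x' a a'
    using w[of "(i, x, a)" "(j, x', a')"] that
    by (subst l2_inner_finite_support[OF T]) (auto simp: w_off)
  define W where "W = (\<lambda>a x \<xi>. \<Sum>i<n. \<xi> i *\<^sub>C w (i, x, a))"
  have W_l2: "W a x \<xi> \<in> l2 T" for a x \<xi>
    unfolding W_def by (intro l2_sum l2_scale w_l2)
  have W_inner: "l2_inner (W a x \<xi>) (W a' x' \<zeta>) = (\<Sum>i<n. \<Sum>j<n. cnj (\<xi> i) * l i j x x' a a' * \<zeta> j)"
    for a x \<xi> a' x' \<zeta>
  proof -
    have "l2_inner (W a x \<xi>) (W a' x' \<zeta>) =
        (\<Sum>i<n. \<Sum>j<n. cnj (\<xi> i) * l2_inner (w (i, x, a)) (w (j, x', a')) * \<zeta> j)"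
      unfolding W_def by (rule l2_inner_combinations[OF w_l2 w_l2])
    then show ?thesis by (simp add: w_inner)
  qed
  define form where "form = (\<lambda>\<xi> \<zeta>. \<Sum>i<n. \<Sum>j<n. cnj (\<xi> i) * c i j * \<zeta> j)"
  have W_rows: "(\<Sum>a\<in>UNIV. l2_inner (W a x \<xi>) (W a x' \<zeta>)) = (if x = x' then form \<xi> \<zeta> else 0)" for x x' \<xi> \<zeta>
  proof -
    have "(\<Sum>a\<in>UNIV. l2_inner (W a x \<xi>) (W a x' \<zeta>)) =
        (\<Sum>i<n. \<Sum>j<n. \<Sum>a\<in>UNIV. cnj (\<xi> i) * l i j x x' a a * \<zeta> j)"
      unfolding W_inner by (subst sum.swap) (intro sum.cong refl sum.swap)
    also have "\<dots> = (\<Sum>i<n. \<Sum>j<n. cnj (\<xi> i) * (if x = x' then c i j else 0) * \<zeta> j)"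
      by (intro sum.cong refl) (simp add: rows flip: sum_distrib_left sum_distrib_right)
    finally show ?thesis by (simp add: form_def)
  qed
  have W_cols: "(\<Sum>x\<in>UNIV. l2_inner (W a x \<xi>) (W a' x \<zeta>)) = (if a = a' then form \<xi> \<zeta> else 0)" for a a' \<xi> \<zeta>
  proof -
    have "(\<Sum>x\<in>UNIV. l2_inner (W a x \<xi>) (W a' x \<zeta>)) =
        (\<Sum>i<n. \<Sum>j<n. \<Sum>x\<in>UNIV. cnj (\<xi> i) * l i j x x a a' * \<zeta> j)"
      unfolding W_inner by (subst sum.swap) (intro sum.cong refl sum.swap)
    also have "\<dots> = (\<Sum>i<n. \<Sum>j<n. cnj (\<xi> i) * (if a = a' then c i j else 0) * \<zeta> j)"
      by (intro sum.cong refl) (simp add: cols flip: sum_distrib_left sum_distrib_right)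
    finally show ?thesis by (simp add: form_def)
  qed
  have norm_form: "complex_of_real (\<Sum>a\<in>UNIV. (l2_norm (W a x \<xi>))\<^sup>2) = form \<xi> \<xi>" for x \<xi>
    using W_rows[of x \<xi> x \<xi>] by (simp only: l2_inner_self[OF W_l2] of_real_sum if_True simp_thms)
  have psd_c: "psd_on {..<n} c"
    unfolding psd_on_def
  proof
    fix \<xi> :: "nat \<Rightarrow> complex"
    have "0 \<le> (\<Sum>a\<in>UNIV. (l2_norm (W a undefined \<xi>))\<^sup>2)" by (intro sum_nonneg) simp
    then have "form \<xi> \<xi> \<in> \<real>\<^sub>\<ge>\<^sub>0"
      unfolding norm_form[of undefined \<xi>, symmetric] by (simp only: nonneg_Reals_of_real_iff)
    then show "(\<Sum>i<n. \<Sum>j<n. cnj (\<xi> i) * c i j * \<xi> j) \<in> \<real>\<^sub>\<ge>\<^sub>0" by (simp only: form_def)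
  qed
  obtain S :: "'i set" and b \<alpha> where S: "finite S" and b_off: "\<And>p i. i \<notin> S \<Longrightarrow> b p i = 0"
    and b: "\<And>p q. p \<in> {..<n} \<Longrightarrow> q \<in> {..<n} \<Longrightarrow> (\<Sum>i\<in>S. cnj (b p i) * b q i) = c p q"
    and span: "\<And>s j. s \<in> S \<Longrightarrow> (\<Sum>p\<in>{..<n}. \<alpha> s p * b p j) = ket s j"
    using Gram_spanning_family[OF inf finite_lessThan psd_c] by blast
  have b_l2: "b p \<in> l2 S" for p by (rule l2_finite_support[OF S]) (use b_off in auto)
  have b_inner: "l2_inner (b i) (b j) = c i j" if "i < n" "j < n" for i j
    using b[of i j] that by (subst l2_inner_finite_support[OF S]) (auto simp: b_off)
  have form_inner: "form \<xi> \<zeta> = l2_inner (\<Sum>i<n. \<xi> i *\<^sub>C b i) (\<Sum>i<n. \<zeta> i *\<^sub>C b i)" for \<xi> \<zeta>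
    by (subst l2_inner_combinations[OF b_l2 b_l2]) (simp add: form_def b_inner)
  \<comment> \<open>A linear choice of coefficients with respect to the spanning family.\<close>
  define \<kappa> where "\<kappa> = (\<lambda>f i. \<Sum>s\<in>S. f s * \<alpha> s i)"
  have \<kappa>: "(\<Sum>i<n. \<kappa> f i *\<^sub>C b i) = f" if f: "f \<in> l2 S" for f
  proof
    fix j
    have "(\<Sum>i<n. \<kappa> f i *\<^sub>C b i) j = (\<Sum>i<n. \<Sum>s\<in>S. f s * (\<alpha> s i * b i j))"
      by (simp add: sum_apply \<kappa>_def sum_distrib_right mult.assoc)
    also have "\<dots> = (\<Sum>s\<in>S. f s * (\<Sum>i<n. \<alpha> s i * b i j))"
      by (subst sum.swap) (simp add: sum_distrib_left)
    also have "\<dots> = (\<Sum>s\<in>S. if s = j then f s else 0)"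
      by (intro sum.cong refl) (auto simp: span ket_def)
    also have "\<dots> = f j" using S l2_off[OF f, of j] by simp
    finally show "(\<Sum>i<n. \<kappa> f i *\<^sub>C b i) j = f j" .
  qed
  have form_\<kappa>: "form (\<kappa> f) (\<kappa> g) = l2_inner f g" if "f \<in> l2 S" "g \<in> l2 S" for f g
    unfolding form_inner \<kappa>[OF that(1)] \<kappa>[OF that(2)] ..
  define V :: "('i, 'x) block_op" where
    "V = \<lparr>dom_ix = S, cod_ix = T, block = (\<lambda>a x f. if f \<in> l2 S then W a x (\<kappa> f) else 0)\<rparr>"
  have dom: "dom_ix V = S" "cod_ix V = T" by (simp_all add: V_def)
  have blk: "block V a x f = W a x (\<kappa> f)" if "f \<in> l2 S" for a x f using that by (simp add: V_def)
  have W_bound: "l2_norm (W a x (\<kappa> f)) \<le> l2_norm f" if f: "f \<in> l2 S" for a x f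
  proof -
    have "(\<Sum>a\<in>UNIV. (l2_norm (W a x (\<kappa> f)))\<^sup>2) = (l2_norm f)\<^sup>2"
      using norm_form[of x "\<kappa> f"] by (simp only: form_\<kappa>[OF f f] l2_inner_self[OF f] of_real_eq_iff)
    moreover have "(l2_norm (W a x (\<kappa> f)))\<^sup>2 \<le> (\<Sum>a\<in>UNIV. (l2_norm (W a x (\<kappa> f)))\<^sup>2)"
      by (rule member_le_sum) auto
    ultimately have "(l2_norm (W a x (\<kappa> f)))\<^sup>2 \<le> (l2_norm f)\<^sup>2" by simp
    then show ?thesis by (rule power2_le_imp_le) simp
  qed
  have op: "block V a x \<in> bop S T" for a x
  proof (rule bopI[where c = 1])
    fix f g assume f: "f \<in> l2 S" and g: "g \<in> l2 S"
    have "\<kappa> (f + g) i = \<kappa> f i + \<kappa> g i" for i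
      by (simp add: \<kappa>_def distrib_right sum.distrib)
    then have "W a x (\<kappa> (f + g)) = W a x (\<kappa> f) + W a x (\<kappa> g)"
      by (simp add: W_def scaleC_add_left sum.distrib)
    then show "block V a x (f + g) = block V a x f + block V a x g"
      by (simp only: blk[OF f] blk[OF g] blk[OF l2_add[OF f g]])
  next
    fix d f assume f: "f \<in> l2 S"
    have "\<kappa> (d *\<^sub>C f) i = d * \<kappa> f i" for i
      by (simp add: \<kappa>_def sum_distrib_left mult_ac)
    then have "W a x (\<kappa> (d *\<^sub>C f)) = d *\<^sub>C W a x (\<kappa> f)"
      by (simp add: W_def complex_vector.scale_sum_right scaleC_scaleC)
    then show "block V a x (d *\<^sub>C f) = d *\<^sub>C block V a x f"
      by (simp only: blk[OF f] blk[OF l2_scale[OF f]])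
  next
    fix f assume f: "f \<in> l2 S"
    show "block V a x f \<in> l2 T" unfolding blk[OF f] by (rule W_l2)
    show "l2_norm (block V a x f) \<le> 1 * l2_norm f" using W_bound[OF f] by (simp add: blk[OF f])
  qed (simp add: V_def)
  have "bi_isometry V"
  proof (rule bi_isometryI, unfold dom)
    show "block V a x \<in> bop S T" for a x by (rule op)
  next
    fix x x' i g assume i: "i \<in> S" and g: "g \<in> l2 S"
    show "(\<Sum>a\<in>UNIV. l2_inner (block V a x (ket i)) (block V a x' g)) = (if x = x' then g i else 0)"
      unfolding blk[OF l2_ket[OF i]] blk[OF g] W_rows form_\<kappa>[OF l2_ket[OF i] g] l2_inner_ket ..
  next
    fix a a' i g assume i: "i \<in> S" and g: "g \<in> l2 S"
    show "(\<Sum>x\<in>UNIV. l2_inner (block V a x (ket i)) (block V a' x g)) = (if a = a' then g i else 0)"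
      unfolding blk[OF l2_ket[OF i]] blk[OF g] W_cols form_\<kappa>[OF l2_ket[OF i] g] l2_inner_ket ..
  qed
  moreover have Vb: "block V a x (b j) = w (j, x, a)" if j: "j < n" for a x j
  proof -
    \<comment> \<open>The coefficients of \<open>b\<^sub>j\<close> are not unique, but their ambiguity is killed by \<open>W\<close>.\<close>
    define \<xi> where "\<xi> = (\<lambda>i. \<kappa> (b j) i - (if i = j then 1 else 0))"
    have diff: "(\<Sum>i<n. \<xi> i *\<^sub>C h i) = (\<Sum>i<n. \<kappa> (b j) i *\<^sub>C h i) - h j" for h :: "nat \<Rightarrow> 'i \<Rightarrow> complex"
    proof -
      have "(\<Sum>i<n. \<xi> i *\<^sub>C h i) = (\<Sum>i<n. \<kappa> (b j) i *\<^sub>C h i) - (\<Sum>i<n. if i = j then h i else 0)"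
        unfolding sum_subtractf[symmetric] \<xi>_def
        by (intro sum.cong refl) (simp add: complex_vector.scale_left_diff_distrib scaleC_one)
      then show ?thesis using j by simp
    qed
    have "(\<Sum>i<n. \<xi> i *\<^sub>C b i) = 0" unfolding diff \<kappa>[OF b_l2] by simp
    then have "form \<xi> \<xi> = 0" by (simp only: form_inner l2_inner_zero)
    then have "(\<Sum>a\<in>UNIV. (l2_norm (W a x \<xi>))\<^sup>2) = 0"
      unfolding norm_form[of x \<xi>, symmetric] by (simp only: of_real_eq_0_iff)
    then have "(l2_norm (W a x \<xi>))\<^sup>2 = 0"
      by (subst (asm) sum_nonneg_eq_0_iff) auto
    then have "W a x \<xi> = 0" by (intro l2_eq_0I[OF W_l2]) (simp add: l2_inner_self[OF W_l2])
    then have "(\<Sum>i<n. \<kappa> (b j) i *\<^sub>C w (i, x, a)) - w (j, x, a) = 0"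
      unfolding W_def by (simp only: diff)
    then show ?thesis unfolding blk[OF b_l2] W_def by simp
  qed
  moreover have "b j \<in> l2 (dom_ix V)" for j unfolding dom by (rule b_l2)
  ultimately show ?thesis
    by (intro exI[of _ V] exI[of _ b]) (simp add: Vb w_inner)
qed

lemma unitary_op_inner:
  assumes "unitary_op S T U" "f \<in> l2 S" "g \<in> l2 S"
  shows "l2_inner (U f) (U g) = l2_inner f g"
proof -
  have U: "U \<in> bop S T" "adj S T U \<circ> U = idop S" using assms(1) by (simp_all only: unitary_op_def)
  have "l2_inner (U f) (U g) = l2_inner f ((adj S T U \<circ> U) g)"
    unfolding o_apply by (rule adj_inner[OF U(1) assms(2) bop_l2[OF U(1) assms(3)], symmetric])
  then show ?thesis using assms(3) by (simp add: U(2) idop_def)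
qed

text \<open>
  Unitary equivalence moves the realising bi-isometry to its representative, which is a direct
  summand of the universal bi-isometry.
\<close>

lemma universal_realising_kernel:
  fixes R :: "('i, 'x::finite) block_op set"
    and l :: "nat \<Rightarrow> nat \<Rightarrow> 'x \<Rightarrow> 'x \<Rightarrow> 'x \<Rightarrow> 'x \<Rightarrow> complex"
  assumes inf: "infinite (UNIV :: 'i set)" and R: "bi_isometry_representatives R"
    and marg: "\<And>i j. i < n \<Longrightarrow> j < n \<Longrightarrow> marginals (l i j) (c i j)"
    and psd: "psd_on ({..<n} \<times> UNIV) (\<lambda>(i, x, a) (j, x', a'). l i j x x' a a')"
  shows "\<exists>\<eta>. (\<forall>j. \<eta> j \<in> l2 (univ_dom R)) \<and>
    (\<forall>i<n. \<forall>j<n. \<forall>x x' a a'. l2_inner (\<eta> i) (univ_e R x x' a a' (\<eta> j)) = l i j x x' a a')"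
proof -
  obtain V :: "('i, 'x) block_op" and b where V: "bi_isometry V" and b: "\<And>j. b j \<in> l2 (dom_ix V)"
    and l: "\<And>i j x x' a a'. i < n \<Longrightarrow> j < n \<Longrightarrow>
      l2_inner (block V a x (b i)) (block V a' x' (b j)) = l i j x x' a a'"
    using bi_isometry_realising_kernel[OF inf marg psd] by blast
  have R': "\<forall>V\<in>R. bi_isometry V" using R unfolding bi_isometry_representatives_def by blast
  obtain W where W: "W \<in> R" "unitarily_equivalent V W"
    using R V unfolding bi_isometry_representatives_def by blast
  obtain U U' where U: "unitary_op (dom_ix V) (dom_ix W) U" and U': "unitary_op (cod_ix V) (cod_ix W) U'"
    and eq: "\<And>a x. block W a x \<circ> U = U' \<circ> block V a x"
    using W(2) unfolding unitarily_equivalent_def by blast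
  have Ub: "U (b j) \<in> l2 (dom_ix W)" for j
    using U b bop_l2 unfolding unitary_op_def by blast
  define \<eta> where "\<eta> = (\<lambda>j. inject W (U (b j)))"
  have \<eta>: "\<eta> j \<in> l2 (univ_dom R)" for j
    unfolding \<eta>_def by (rule inject_l2[where D = dom_ix, OF Ub W(1)])
  have v\<eta>: "univ_v R a x (\<eta> j) = inject W (U' (block V a x (b j)))" for a x j
    unfolding \<eta>_def univ_v_inject[OF R' W(1) Ub] using fun_cong[OF eq, of a x "b j"] by simp
  have vb: "block V a x (b j) \<in> l2 (cod_ix V)" for a x j
    by (rule bop_l2[OF bi_isometry_bop[OF V] b])
  show ?thesis
  proof (intro exI[of _ \<eta>] conjI allI impI)
    show "\<eta> j \<in> l2 (univ_dom R)" for j by (rule \<eta>)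
    fix i j x x' a a' assume "i < n" "j < n"
    then show "l2_inner (\<eta> i) (univ_e R x x' a a' (\<eta> j)) = l i j x x' a a'"
      unfolding univ_e_inner[OF R' \<eta> \<eta>] v\<eta> l2_inner_inject slice_inject
        unitary_op_inner[OF U' vb vb] by (rule l)
  qed
qed

section \<open>Functionals on the universal system\<close>

lemma dual_vecs_add:
  assumes "\<phi> \<in> dual_vecs \<S>" "u \<in> vecs \<S>" "v \<in> vecs \<S>"
  shows "\<phi> (u + v) = \<phi> u + \<phi> v"
  using assms unfolding dual_vecs_def clinear_on_def by blast

lemma dual_vecs_scale:
  assumes "\<phi> \<in> dual_vecs \<S>" "u \<in> vecs \<S>"
  shows "\<phi> (c *\<^sub>C u) = c * \<phi> u"
  using assms unfolding dual_vecs_def clinear_on_def by simp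

lemma dual_vecs_zero: "\<phi> \<in> dual_vecs \<S> \<Longrightarrow> complex_vector.subspace (vecs \<S>) \<Longrightarrow> \<phi> 0 = 0"
  using dual_vecs_scale[of \<phi> \<S> 0 0] by (simp add: complex_vector.subspace_0)

lemma dual_vecs_sum:
  assumes \<phi>: "\<phi> \<in> dual_vecs \<S>" and sub: "complex_vector.subspace (vecs \<S>)"
    and u: "\<And>k. k \<in> A \<Longrightarrow> u k \<in> vecs \<S>"
  shows "\<phi> (\<Sum>k\<in>A. u k) = (\<Sum>k\<in>A. \<phi> (u k))"
  using u
proof (induction A rule: infinite_finite_induct)
  case (insert k A)
  have "\<phi> (u k + (\<Sum>k\<in>A. u k)) = \<phi> (u k) + \<phi> (\<Sum>k\<in>A. u k)"
    by (rule dual_vecs_add[OF \<phi>])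
      (use insert.prems complex_vector.subspace_sum[OF sub, of A u] in auto)
  then show ?case using insert by simp
qed (simp_all add: dual_vecs_zero[OF \<phi> sub])

lemma vecs_T: "vecs (T_system R) = complex_vector.span {univ_e R x x' a a' | x x' a a'. True}"
  by (simp add: T_system_def subsystem_def)

lemma univ_e_in_T: "univ_e R x x' a a' \<in> vecs (T_system R)"
  unfolding vecs_T by (rule complex_vector.span_base) blast

lemma subspace_T: "complex_vector.subspace (vecs (T_system R))"
  unfolding vecs_T by (rule complex_vector.subspace_span)

lemma T_induct [consumes 1, case_names gen zero add scale]:
  assumes "u \<in> vecs (T_system R)" "\<And>x x' a a'. P (univ_e R x x' a a')" "P 0"
    "\<And>u v. u \<in> vecs (T_system R) \<Longrightarrow> v \<in> vecs (T_system R) \<Longrightarrow> P u \<Longrightarrow> P v \<Longrightarrow> P (u + v)"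
    "\<And>c u. u \<in> vecs (T_system R) \<Longrightarrow> P u \<Longrightarrow> P (c *\<^sub>C u)"
  shows "P u"
proof -
  have "u \<in> vecs (T_system R) \<and> P u"
    using assms(1) unfolding vecs_T
  proof (rule complex_vector.span_induct_alt)
    show "0 \<in> complex_vector.span {univ_e R x x' a a' | x x' a a'. True} \<and> P 0"
      using assms(3) complex_vector.span_zero by blast
    fix c v w
    assume v: "v \<in> {univ_e R x x' a a' | x x' a a'. True}"
      and w: "w \<in> complex_vector.span {univ_e R x x' a a' | x x' a a'. True} \<and> P w"
    have vT: "v \<in> vecs (T_system R)" unfolding vecs_T by (rule complex_vector.span_base[OF v])
    have cv: "c *\<^sub>C v \<in> vecs (T_system R)" by (rule complex_vector.subspace_scale[OF subspace_T vT])
    have wT: "w \<in> vecs (T_system R)" using w unfolding vecs_T by blast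
    have "P v" using v assms(2) by blast
    then have "P (c *\<^sub>C v + w)" using assms(4)[OF cv wT assms(5)[OF vT]] w by blast
    moreover have "c *\<^sub>C v + w \<in> vecs (T_system R)" by (rule complex_vector.subspace_add[OF subspace_T cv wT])
    ultimately show "c *\<^sub>C v + w \<in> complex_vector.span {univ_e R x x' a a' | x x' a a'. True} \<and> P (c *\<^sub>C v + w)"
      unfolding vecs_T by blast
  qed
  then show ?thesis by blast
qed

text \<open>
  Injectivity of \<open>Lambda_map\<close> rests on this: a linear functional is determined on a spanning set.
\<close>

lemma dual_vecs_T_eqI:
  assumes \<phi>: "\<phi> \<in> dual_vecs (T_system R)" and \<psi>: "\<psi> \<in> dual_vecs (T_system R)"
    and eq: "\<And>x x' a a'. \<phi> (univ_e R x x' a a') = \<psi> (univ_e R x x' a a')"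
  shows "\<phi> = \<psi>"
proof
  fix u show "\<phi> u = \<psi> u"
  proof (cases "u \<in> vecs (T_system R)")
    case True
    then show ?thesis
    proof (induction rule: T_induct)
      case zero
      show ?case by (simp only: dual_vecs_zero[OF \<phi> subspace_T] dual_vecs_zero[OF \<psi> subspace_T])
    next
      case (add u v)
      then show ?case by (simp only: dual_vecs_add[OF \<phi>] dual_vecs_add[OF \<psi>])
    next
      case (scale c u)
      then show ?case by (simp only: dual_vecs_scale[OF \<phi>] dual_vecs_scale[OF \<psi>])
    qed (rule eq)
  next
    case False
    then show ?thesis using \<phi> \<psi> by (simp add: dual_vecs_def)
  qed
qed

lemma mcone_T_D:
  assumes "u \<in> mcone (T_system R) m" "i < m" "j < m"
  shows "u i j \<in> vecs (T_system R)" "u i j \<in> bop (univ_dom R) (univ_dom R)"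
  using assms by (simp_all add: T_system_def C_system_def B_system_def subsystem_def)

lemma mcone_T_pos:
  assumes "u \<in> mcone (T_system R) m" "\<And>i. i < m \<Longrightarrow> \<xi> i \<in> l2 (univ_dom R)"
  shows "(\<Sum>i<m. \<Sum>j<m. l2_inner (\<xi> i) (u i j (\<xi> j))) \<in> \<real>\<^sub>\<ge>\<^sub>0"
  using assms by (simp add: T_system_def C_system_def B_system_def subsystem_def)

text \<open>The matrix has the form \<open>V\<^sup>*V\<close> for the row operator \<open>V\<close> with entries \<open>v\<^sub>a\<^sub>,\<^sub>x\<close>.\<close>

lemma univ_e_matrix_positive:
  assumes R: "\<forall>V\<in>R. bi_isometry V"
  shows "(\<lambda>k l. univ_e R (fst (h k)) (fst (h l)) (snd (h k)) (snd (h l))) \<in> mcone (T_system R) m"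
proof -
  define u where "u = (\<lambda>k l. univ_e R (fst (h k)) (fst (h l)) (snd (h k)) (snd (h l)))"
  have op: "u k l \<in> bop (univ_dom R) (univ_dom R)" for k l
    unfolding u_def by (rule univ_e_bop[OF R])
  have T: "u k l \<in> vecs (T_system R)" for k l
    unfolding u_def by (rule univ_e_in_T)
  have C: "u k l \<in> cstar_generated (univ_dom R) {univ_e R x x' a a' | x x' a a'. True}" for k l
    unfolding u_def cstar_generated_def by blast
  have pos: "(\<Sum>i<m. \<Sum>j<m. l2_inner (\<xi> i) (u i j (\<xi> j))) \<in> \<real>\<^sub>\<ge>\<^sub>0"
    if \<xi>: "\<And>i. i < m \<Longrightarrow> \<xi> i \<in> l2 (univ_dom R)" for \<xi>
  proof -
    define z where "z = (\<lambda>k. univ_v R (snd (h k)) (fst (h k)) (\<xi> k))"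
    have z: "z k \<in> l2 (univ_cod R)" if "k < m" for k
      unfolding z_def by (rule bop_l2[OF univ_v_bop[OF R] \<xi>[OF that]])
    have Z: "(\<Sum>j<m. z j) \<in> l2 (univ_cod R)" by (rule l2_sum) (simp add: z)
    have "(\<Sum>i<m. \<Sum>j<m. l2_inner (\<xi> i) (u i j (\<xi> j))) = (\<Sum>i<m. \<Sum>j<m. l2_inner (z i) (z j))"
      by (intro sum.cong refl) (simp add: u_def z_def univ_e_inner[OF R] \<xi>)
    also have "\<dots> = (\<Sum>i<m. l2_inner (z i) (\<Sum>j<m. z j))"
      by (rule sum.cong[OF refl], subst l2_inner_sum_right[of _ "univ_cod R" _ _ "univ_cod R"]) (simp_all add: z)
    also have "\<dots> = l2_inner (\<Sum>i<m. z i) (\<Sum>j<m. z j)"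
      by (rule l2_inner_sum_left[OF Z, symmetric]) (rule z, simp)
    finally show ?thesis using l2_inner_self_nonneg[OF Z] by simp
  qed
  have "u \<in> mcone (T_system R) m"
    using op C T[unfolded vecs_T] pos by (simp add: T_system_def C_system_def B_system_def subsystem_def)
  then show ?thesis by (simp only: u_def)
qed

definition vector_functional ::
    "('i, 'x::finite) block_op set \<Rightarrow> (('i, 'x) block_op \<times> 'i \<Rightarrow> complex) \<Rightarrow>
     (('i, 'x) block_op \<times> 'i \<Rightarrow> complex) \<Rightarrow>
     (('i, 'x) block_op \<times> 'i, ('i, 'x) block_op \<times> 'i) oper \<Rightarrow> complex"
  where "vector_functional R f g u = (if u \<in> vecs (T_system R) then l2_inner f (u g) else 0)"

lemma T_l2:
  assumes R: "\<forall>V\<in>R. bi_isometry V" and u: "u \<in> vecs (T_system R)" and g: "g \<in> l2 (univ_dom R)"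
  shows "u g \<in> l2 (univ_dom R)"
  using u
proof (induction rule: T_induct)
  case (gen x x' a a')
  show ?case by (rule bop_l2[OF univ_e_bop[OF R] g])
next
  case zero
  show ?case unfolding zero_fun_apply[where x = g] by (rule l2_zero)
next
  case (add u v)
  then show ?case unfolding plus_fun_apply[where x = g] by (intro l2_add)
next
  case (scale c u)
  then show ?case unfolding scaleC_apply[where i = g] by (intro l2_scale)
qed

lemma vector_functional_dual:
  assumes R: "\<forall>V\<in>R. bi_isometry V" and f: "f \<in> l2 (univ_dom R)" and g: "g \<in> l2 (univ_dom R)"
  shows "vector_functional R f g \<in> dual_vecs (T_system R)"
  unfolding dual_vecs_def clinear_on_def
proof (intro CollectI conjI ballI allI impI)
  fix u v assume u: "u \<in> vecs (T_system R)" and v: "v \<in> vecs (T_system R)"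
  have "u + v \<in> vecs (T_system R)" by (rule complex_vector.subspace_add[OF subspace_T u v])
  then show "vector_functional R f g (u + v) = vector_functional R f g u + vector_functional R f g v"
    using u v l2_inner_add_right[OF f T_l2[OF R u g] T_l2[OF R v g]]
    by (simp add: vector_functional_def)
next
  fix c u assume u: "u \<in> vecs (T_system R)"
  have "c *\<^sub>C u \<in> vecs (T_system R)" by (rule complex_vector.subspace_scale[OF subspace_T u])
  then show "vector_functional R f g (c *\<^sub>C u) = c *\<^sub>C vector_functional R f g u"
    using u by (simp add: vector_functional_def l2_inner_scale_right)
qed (simp add: vector_functional_def)

text \<open>
  For \<open>z\<^sub>k = \<Sum>\<^sub>p \<xi>\<^sub>k\<^sub>p \<eta>\<^sub>p\<close>, the quadratic form of \<open>(\<phi>\<^sub>p\<^sub>q(u\<^sub>k\<^sub>l))\<close> at \<open>\<xi>\<close> is \<open>\<Sum>\<^sub>k\<^sub>l \<langle>z\<^sub>k, u\<^sub>k\<^sub>l z\<^sub>l\<rangle>\<close>, which is the form of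
  \<open>(u\<^sub>k\<^sub>l)\<close> itself at \<open>z\<close>.
\<close>

lemma vector_functional_mcone:
  assumes R: "\<forall>V\<in>R. bi_isometry V" and \<eta>: "\<And>i. \<eta> i \<in> l2 (univ_dom R)"
  shows "(\<lambda>i j. vector_functional R (\<eta> i) (\<eta> j)) \<in> mcone (dual_system (T_system R)) n"
proof -
  define F where "F = (\<lambda>u i j. if i < n \<and> j < n then vector_functional R (\<eta> i) (\<eta> j) u else 0)"
  have dual: "vector_functional R (\<eta> i) (\<eta> j) \<in> dual_vecs (T_system R)" for i j
    by (rule vector_functional_dual[OF R \<eta> \<eta>])
  have "completely_positive (T_system R) (M_system n) F"
    unfolding completely_positive_def
  proof (intro conjI allI ballI)
    show "clinear_on (vecs (T_system R)) F"
      unfolding clinear_on_def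
      by (auto simp: F_def fun_eq_iff dual_vecs_add[OF dual] dual_vecs_scale[OF dual])
    show "F ` vecs (T_system R) \<subseteq> vecs (M_system n)"
      by (auto simp: F_def M_system_def Let_def)
    fix m u assume u: "u \<in> mcone (T_system R) m"
    have "(\<Sum>k<m. \<Sum>l<m. \<Sum>p<n. \<Sum>q<n. cnj (\<xi> k p) * F (u k l) p q * \<xi> l q) \<in> \<real>\<^sub>\<ge>\<^sub>0" for \<xi>
    proof -
      define z where "z = (\<lambda>k. \<Sum>p<n. \<xi> k p *\<^sub>C \<eta> p)"
      have z: "z k \<in> l2 (univ_dom R)" for k
        unfolding z_def by (intro l2_sum l2_scale \<eta>)
      have "(\<Sum>p<n. \<Sum>q<n. cnj (\<xi> k p) * F (u k l) p q * \<xi> l q) = l2_inner (z k) (u k l (z l))"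
        if kl: "k < m" "l < m" for k l
      proof -
        note op = mcone_T_D(2)[OF u kl]
        have "u k l (z l) = (\<Sum>q<n. u k l (\<xi> l q *\<^sub>C \<eta> q))"
          unfolding z_def by (rule bop_sum[OF op l2_scale[OF \<eta>]])
        also have "\<dots> = (\<Sum>q<n. \<xi> l q *\<^sub>C u k l (\<eta> q))"
          by (rule sum.cong[OF refl], rule bop_scale[OF op \<eta>])
        finally have "l2_inner (z k) (u k l (z l)) =
            (\<Sum>p<n. \<Sum>q<n. cnj (\<xi> k p) * l2_inner (\<eta> p) (u k l (\<eta> q)) * \<xi> l q)"
          unfolding z_def by (simp only: l2_inner_combinations[OF \<eta> bop_l2[OF op \<eta>]])
        also have "\<dots> = (\<Sum>p<n. \<Sum>q<n. cnj (\<xi> k p) * F (u k l) p q * \<xi> l q)"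
          by (intro sum.cong refl) (simp add: F_def vector_functional_def mcone_T_D(1)[OF u kl])
        finally show ?thesis ..
      qed
      then have "(\<Sum>k<m. \<Sum>l<m. \<Sum>p<n. \<Sum>q<n. cnj (\<xi> k p) * F (u k l) p q * \<xi> l q) =
          (\<Sum>k<m. \<Sum>l<m. l2_inner (z k) (u k l (z l)))"
        by simp
      then show ?thesis using mcone_T_pos[OF u z] by simp
    qed
    then show "(\<lambda>i j. F (u i j)) \<in> mcone (M_system n) m"
      by (simp add: M_system_def Let_def) (simp add: F_def)
  qed
  then show ?thesis using dual by (simp add: dual_system_def F_def)
qed

section \<open>The coefficient matrices\<close>

definition entries :: "complex ^ ('x \<times> 'x) ^ ('x \<times> 'x) \<Rightarrow> 'x::finite \<Rightarrow> 'x \<Rightarrow> 'x \<Rightarrow> 'x \<Rightarrow> complex"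
  where "entries M = (\<lambda>x x' a a'. M $ (x, a) $ (x', a'))"

lemma coeff_matrix_nth: "coeff_matrix l $ (x, a) $ (x', a') = l x x' a a'"
proof -
  have "coeff_matrix l $ (x, a) $ (x', a') =
      (\<Sum>y\<in>UNIV. \<Sum>y'\<in>UNIV. \<Sum>b\<in>UNIV. \<Sum>b'\<in>UNIV.
        if y = x then if y' = x' then if b = a then if b' = a' then l y y' b b' else 0 else 0 else 0 else 0)"
    unfolding coeff_matrix_def sum_component
    by (intro sum.cong refl) (auto simp: scaleC_vec_def kronecker_def matrix_unit_def)
  also have "\<dots> = l x x' a a'"
  proof -
    have pull: "(\<Sum>b\<in>UNIV. if P then f b else 0) = (if P then \<Sum>b\<in>UNIV. f b else 0)"
      for P and f :: "'a \<Rightarrow> complex"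
      by simp
    show ?thesis by (simp add: pull)
  qed
  finally show ?thesis .
qed

lemma entries_coeff_matrix: "entries (coeff_matrix l) = l"
  by (simp add: entries_def coeff_matrix_nth fun_eq_iff)

lemma coeff_matrix_entries: "coeff_matrix (entries M) = M"
  by (simp add: vec_eq_iff coeff_matrix_nth entries_def split_paired_all)

lemma vecs_L: "M \<in> vecs L_system \<longleftrightarrow> (\<exists>c. marginals (entries M) c)"
proof -
  have "M \<in> vecs L_system \<longleftrightarrow> (\<exists>l. M = coeff_matrix l \<and> (\<exists>c. marginals l c))"
    by (simp add: L_system_def subsystem_def marginals_def)
  also have "\<dots> \<longleftrightarrow> (\<exists>c. marginals (entries M) c)"
    by (metis entries_coeff_matrix coeff_matrix_entries)
  finally show ?thesis .
qed

lemma sum_pairs: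
  fixes f :: "'a \<times> 'b \<Rightarrow> 'a \<times> 'b \<Rightarrow> 'c::comm_monoid_add"
  shows "(\<Sum>P\<in>A \<times> B. \<Sum>Q\<in>A \<times> B. f P Q) = (\<Sum>i\<in>A. \<Sum>j\<in>A. \<Sum>p\<in>B. \<Sum>q\<in>B. f (i, p) (j, q))"
proof -
  have "(\<Sum>P\<in>A \<times> B. \<Sum>Q\<in>A \<times> B. f P Q) = (\<Sum>i\<in>A. \<Sum>p\<in>B. \<Sum>j\<in>A. \<Sum>q\<in>B. f (i, p) (j, q))"
  proof -
    have "(\<Sum>P\<in>A \<times> B. g P) = (\<Sum>i\<in>A. \<Sum>p\<in>B. g (i, p))" for g :: "_ \<Rightarrow> 'c"
      by (simp add: sum.cartesian_product)
    then show ?thesis by simp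
  qed
  also have "\<dots> = (\<Sum>i\<in>A. \<Sum>j\<in>A. \<Sum>p\<in>B. \<Sum>q\<in>B. f (i, p) (j, q))"
    by (rule sum.cong[OF refl], rule sum.swap)
  finally show ?thesis .
qed

lemma mcone_L:
  "u \<in> mcone L_system n \<longleftrightarrow> (\<forall>i<n. \<forall>j<n. u i j \<in> vecs L_system) \<and>
    psd_on ({..<n} \<times> UNIV) (\<lambda>(i, p) (j, q). u i j $ p $ q)"
proof -
  have eq: "(\<Sum>i<n. \<Sum>j<n. \<Sum>p\<in>UNIV. cnj (\<xi> i $ p) * (u i j *v \<xi> j) $ p) =
      (\<Sum>P\<in>{..<n} \<times> UNIV. \<Sum>Q\<in>{..<n} \<times> UNIV. cnj (case P of (i, p) \<Rightarrow> \<xi> i $ p) *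
        (case P of (i, p) \<Rightarrow> \<lambda>(j, q). u i j $ p $ q) Q * (case Q of (j, q) \<Rightarrow> \<xi> j $ q))"
    for \<xi> :: "nat \<Rightarrow> complex ^ ('a \<times> 'a)"
    unfolding sum_pairs
    by (simp add: matrix_vector_mult_def sum_distrib_left mult.assoc)
  have "psd_on ({..<n} \<times> UNIV) (\<lambda>(i, p) (j, q). u i j $ p $ q) \<longleftrightarrow>
      (\<forall>\<xi> :: nat \<Rightarrow> complex ^ ('a \<times> 'a).
        (\<Sum>i<n. \<Sum>j<n. \<Sum>p\<in>UNIV. cnj (\<xi> i $ p) * (u i j *v \<xi> j) $ p) \<in> \<real>\<^sub>\<ge>\<^sub>0)"
  proof
    assume "psd_on ({..<n} \<times> UNIV) (\<lambda>(i, p) (j, q). u i j $ p $ q)"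
    then show "\<forall>\<xi> :: nat \<Rightarrow> complex ^ ('a \<times> 'a).
        (\<Sum>i<n. \<Sum>j<n. \<Sum>p\<in>UNIV. cnj (\<xi> i $ p) * (u i j *v \<xi> j) $ p) \<in> \<real>\<^sub>\<ge>\<^sub>0"
      unfolding eq psd_on_def by blast
  next
    assume *: "\<forall>\<xi> :: nat \<Rightarrow> complex ^ ('a \<times> 'a).
        (\<Sum>i<n. \<Sum>j<n. \<Sum>p\<in>UNIV. cnj (\<xi> i $ p) * (u i j *v \<xi> j) $ p) \<in> \<real>\<^sub>\<ge>\<^sub>0"
    show "psd_on ({..<n} \<times> UNIV) (\<lambda>(i, p) (j, q). u i j $ p $ q)"
      unfolding psd_on_def
    proof
      fix \<zeta> :: "nat \<times> 'a \<times> 'a \<Rightarrow> complex"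
      show "(\<Sum>P\<in>{..<n} \<times> UNIV. \<Sum>Q\<in>{..<n} \<times> UNIV. cnj (\<zeta> P) *
          (case P of (i, p) \<Rightarrow> \<lambda>(j, q). u i j $ p $ q) Q * \<zeta> Q) \<in> \<real>\<^sub>\<ge>\<^sub>0"
        using *[rule_format, of "\<lambda>i. \<chi> p. \<zeta> (i, p)"] unfolding eq by (simp add: case_prod_unfold)
    qed
  qed
  then show ?thesis
    by (auto simp: L_system_def subsystem_def matrix_system_def)
qed

text \<open>
  An off-diagonal corner of a positive \<open>2 \<times> 2\<close> block matrix is arbitrary, provided that the
  diagonal dominates it.
\<close>

lemma psd_on_corner:
  fixes M :: "'p::finite \<Rightarrow> 'p \<Rightarrow> complex"
  defines "t \<equiv> complex_of_real (\<Sum>p\<in>UNIV. \<Sum>q\<in>UNIV. cmod (M p q))"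
  shows "psd_on ({..<2::nat} \<times> UNIV) (\<lambda>(i, p) (j, q).
    if i = j then (if p = q then t else 0) else if i = 0 then M p q else cnj (M q p))"
  unfolding psd_on_def
proof
  fix \<xi> :: "nat \<times> 'p \<Rightarrow> complex"
  define T where "T = (\<Sum>p\<in>UNIV. \<Sum>q\<in>UNIV. cmod (M p q))"
  define N where "N = (\<lambda>i. \<Sum>p\<in>UNIV. (cmod (\<xi> (i, p)))\<^sup>2)"
  define X where "X = (\<Sum>p\<in>UNIV. \<Sum>q\<in>UNIV. cnj (\<xi> (0, p)) * M p q * \<xi> (1, q))"
  have diag: "(\<Sum>p\<in>UNIV. \<Sum>q\<in>UNIV. cnj (\<xi> (i, p)) * (if p = q then t else 0) * \<xi> (i, q)) = of_real (T * N i)" for i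
  proof -
    have "(\<Sum>p\<in>UNIV. \<Sum>q\<in>UNIV. cnj (\<xi> (i, p)) * (if p = q then t else 0) * \<xi> (i, q))
        = (\<Sum>p\<in>UNIV. t * (cnj (\<xi> (i, p)) * \<xi> (i, p)))"
    proof (rule sum.cong[OF refl])
      fix p
      have "(\<Sum>q\<in>UNIV. cnj (\<xi> (i, p)) * (if p = q then t else 0) * \<xi> (i, q)) =
          (\<Sum>q\<in>UNIV. if p = q then t * (cnj (\<xi> (i, p)) * \<xi> (i, q)) else 0)"
        by (intro sum.cong refl) auto
      then show "(\<Sum>q\<in>UNIV. cnj (\<xi> (i, p)) * (if p = q then t else 0) * \<xi> (i, q)) = t * (cnj (\<xi> (i, p)) * \<xi> (i, p))"
        by simp
    qed
    also have "\<dots> = of_real (T * N i)"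
      unfolding cnj_mult_self t_def T_def N_def sum_distrib_left[symmetric] of_real_mult of_real_sum ..
    finally show ?thesis .
  qed
  have adjX: "(\<Sum>p\<in>UNIV. \<Sum>q\<in>UNIV. cnj (\<xi> (1, p)) * cnj (M q p) * \<xi> (0, q)) = cnj X"
    unfolding X_def by (subst sum.swap) (simp add: mult_ac)
  have "(\<Sum>P\<in>{..<2::nat} \<times> UNIV. \<Sum>Q\<in>{..<2::nat} \<times> UNIV. cnj (\<xi> P) * (case P of (i, p) \<Rightarrow> \<lambda>(j, q).
      if i = j then (if p = q then t else 0) else if i = 0 then M p q else cnj (M q p)) Q * \<xi> Q)
      = of_real (T * N 0) + X + (cnj X + of_real (T * N 1))"
  proof -
    have two: "{..<2::nat} = {0, 1}" by auto
    show ?thesis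
      unfolding sum_pairs two
      by (simp only: diag adjX X_def[symmetric] prod.case sum.insert finite.intros sum.empty
          empty_iff insert_iff zero_neq_one one_neq_zero simp_thms if_True if_False add_0_right)
  qed
  also have "\<dots> = of_real (T * (N 0 + N 1) + 2 * Re X)"
    by (simp add: complex_eq_iff distrib_left)
  also have "\<dots> \<in> \<real>\<^sub>\<ge>\<^sub>0"
  proof -
    have "cmod X \<le> (\<Sum>p\<in>UNIV. \<Sum>q\<in>UNIV. cmod (M p q) * ((N 0 + N 1) / 2))"
      unfolding X_def
    proof (intro order_trans[OF norm_sum] sum_mono)
      fix p q
      have le: "(cmod (\<xi> (i, r)))\<^sup>2 \<le> N i" for i r
        unfolding N_def by (rule member_le_sum) auto
      have "cmod (\<xi> (0, p)) * cmod (\<xi> (1, q)) \<le> (N 0 + N 1) / 2"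
        using sum_squares_bound[of "cmod (\<xi> (0, p))" "cmod (\<xi> (1, q))"] le[of 0 p] le[of 1 q] by simp
      then have "cmod (M p q) * (cmod (\<xi> (0, p)) * cmod (\<xi> (1, q))) \<le> cmod (M p q) * ((N 0 + N 1) / 2)"
        by (rule mult_left_mono) simp
      then show "cmod (cnj (\<xi> (0, p)) * M p q * \<xi> (1, q)) \<le> cmod (M p q) * ((N 0 + N 1) / 2)"
        by (simp add: norm_mult mult_ac)
    qed
    also have "\<dots> = T * ((N 0 + N 1) / 2)"
      by (simp only: T_def sum_distrib_right)
    finally have "- Re X \<le> T * ((N 0 + N 1) / 2)"
      using abs_Re_le_cmod[of X] by linarith
    then have "0 \<le> T * (N 0 + N 1) + 2 * Re X" by simp
    then show ?thesis by (simp only: nonneg_Reals_of_real_iff)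
  qed
  finally show "(\<Sum>P\<in>{..<2::nat} \<times> UNIV. \<Sum>Q\<in>{..<2::nat} \<times> UNIV. cnj (\<xi> P) * (case P of (i, p) \<Rightarrow> \<lambda>(j, q).
      if i = j then (if p = q then t else 0) else if i = 0 then M p q else cnj (M q p)) Q * \<xi> Q) \<in> \<real>\<^sub>\<ge>\<^sub>0" .
qed

section \<open>The isomorphism between the dual and the marginal matrices\<close>

lemma Lambda_map_nth: "Lambda_map R \<phi> $ (x, a) $ (x', a') = \<phi> (univ_e R x x' a a')"
  by (simp add: Lambda_map_def coeff_matrix_nth)

text \<open>
  The constant in the marginal conditions is the value of the functional at the identity.
\<close>

lemma Lambda_map_in_L:
  assumes R: "\<forall>V\<in>R. bi_isometry V" and \<phi>: "\<phi> \<in> dual_vecs (T_system R)"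
  shows "Lambda_map R \<phi> \<in> vecs L_system"
proof -
  have z: "\<phi> 0 = 0" by (rule dual_vecs_zero[OF \<phi> subspace_T])
  have "marginals (\<lambda>x x' a a'. \<phi> (univ_e R x x' a a')) (\<phi> (idop (univ_dom R)))"
    unfolding marginals_def
      dual_vecs_sum[OF \<phi> subspace_T univ_e_in_T, symmetric] univ_e_rows[OF R] univ_e_cols[OF R]
    by (simp add: z)
  then show ?thesis unfolding vecs_L Lambda_map_def entries_coeff_matrix by blast
qed

lemma Lambda_map_inj:
  assumes "\<phi> \<in> dual_vecs (T_system R)" "\<psi> \<in> dual_vecs (T_system R)" "Lambda_map R \<phi> = Lambda_map R \<psi>"
  shows "\<phi> = \<psi>"
  using assms(1,2)
proof (rule dual_vecs_T_eqI)
  show "\<phi> (univ_e R x x' a a') = \<psi> (univ_e R x x' a a')" for x x' a a'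
    using assms(3) by (simp only: Lambda_map_nth[symmetric])
qed

text \<open>
  Applying the completely positive map given by \<open>(\<phi>\<^sub>i\<^sub>j)\<close> to the positive matrix of all generators yields
  the matrix of \<open>Lambda_map\<close>, up to the order of the two pairs of indices and an enumeration \<open>h\<close> of
  \<open>X \<times> X\<close>.
\<close>

lemma Lambda_map_mcone:
  fixes R :: "('i, 'x::finite) block_op set"
  assumes R: "\<forall>V\<in>R. bi_isometry V" and \<phi>: "\<phi> \<in> mcone (dual_system (T_system R)) n"
  shows "(\<lambda>i j. Lambda_map R (\<phi> i j)) \<in> mcone L_system n"
  unfolding mcone_L
proof (intro conjI allI impI)
  fix i j assume "i < n" "j < n"
  then show "Lambda_map R (\<phi> i j) \<in> vecs L_system"
    using \<phi> by (intro Lambda_map_in_L[OF R]) (simp add: dual_system_def)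
next
  define F where "F = (\<lambda>u i j. if i < n \<and> j < n then \<phi> i j u else 0)"
  define m where "m = CARD('x \<times> 'x)"
  obtain h where h: "bij_betw h {..<m} (UNIV :: ('x \<times> 'x) set)"
    using ex_bij_betw_nat_finite[of "UNIV :: ('x \<times> 'x) set"] by (auto simp: m_def lessThan_atLeast0)
  define e where "e = (\<lambda>k l. univ_e R (fst (h k)) (fst (h l)) (snd (h k)) (snd (h l)))"
  have "completely_positive (T_system R) (M_system n) F"
    using \<phi> by (simp add: dual_system_def F_def)
  moreover have "e \<in> mcone (T_system R) m"
    unfolding e_def by (rule univ_e_matrix_positive[OF R])
  ultimately have "(\<lambda>k l. F (e k l)) \<in> mcone (M_system n) m"
    unfolding completely_positive_def by blast
  then have pos: "(\<Sum>k<m. \<Sum>l<m. \<Sum>i<n. \<Sum>j<n. cnj (\<xi> k i) * F (e k l) i j * \<xi> l j) \<in> \<real>\<^sub>\<ge>\<^sub>0" for \<xi>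
    by (simp add: M_system_def Let_def)
  show "psd_on ({..<n} \<times> UNIV) (\<lambda>(i, p) (j, q). Lambda_map R (\<phi> i j) $ p $ q)"
    unfolding psd_on_def
  proof
    fix \<zeta> :: "nat \<times> 'x \<times> 'x \<Rightarrow> complex"
    define G where "G = (\<lambda>p q. \<Sum>i<n. \<Sum>j<n. cnj (\<zeta> (i, p)) * Lambda_map R (\<phi> i j) $ p $ q * \<zeta> (j, q))"
    have "(\<Sum>P\<in>{..<n} \<times> UNIV. \<Sum>Q\<in>{..<n} \<times> UNIV. cnj (\<zeta> P) *
        (case P of (i, p) \<Rightarrow> \<lambda>(j, q). Lambda_map R (\<phi> i j) $ p $ q) Q * \<zeta> Q)
      = (\<Sum>i<n. \<Sum>j<n. \<Sum>p\<in>UNIV. \<Sum>q\<in>UNIV. cnj (\<zeta> (i, p)) * Lambda_map R (\<phi> i j) $ p $ q * \<zeta> (j, q))"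
      unfolding sum_pairs by simp
    also have "\<dots> = (\<Sum>i<n. \<Sum>p\<in>UNIV. \<Sum>j<n. \<Sum>q\<in>UNIV. cnj (\<zeta> (i, p)) * Lambda_map R (\<phi> i j) $ p $ q * \<zeta> (j, q))"
      by (rule sum.cong[OF refl], rule sum.swap)
    also have "\<dots> = (\<Sum>p\<in>UNIV. \<Sum>i<n. \<Sum>j<n. \<Sum>q\<in>UNIV. cnj (\<zeta> (i, p)) * Lambda_map R (\<phi> i j) $ p $ q * \<zeta> (j, q))"
      by (rule sum.swap)
    also have "\<dots> = (\<Sum>p\<in>UNIV. \<Sum>i<n. \<Sum>q\<in>UNIV. \<Sum>j<n. cnj (\<zeta> (i, p)) * Lambda_map R (\<phi> i j) $ p $ q * \<zeta> (j, q))"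
      by (rule sum.cong[OF refl], rule sum.cong[OF refl], rule sum.swap)
    also have "\<dots> = (\<Sum>p\<in>UNIV. \<Sum>q\<in>UNIV. G p q)"
      unfolding G_def by (rule sum.cong[OF refl], rule sum.swap)
    also have "\<dots> = (\<Sum>k<m. \<Sum>l<m. G (h k) (h l))"
    proof -
      have "(\<Sum>p\<in>UNIV. S p) = (\<Sum>k<m. S (h k))" for S :: "'x \<times> 'x \<Rightarrow> complex"
        by (rule sum.reindex_bij_betw[OF h, symmetric])
      then show ?thesis by (simp only:)
    qed
    also have "\<dots> = (\<Sum>k<m. \<Sum>l<m. \<Sum>i<n. \<Sum>j<n. cnj (\<zeta> (i, h k)) * F (e k l) i j * \<zeta> (j, h l))"
    proof (intro sum.cong refl)
      fix k l
      have "Lambda_map R (\<phi> i j) $ h k $ h l = \<phi> i j (e k l)" for i j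
        using Lambda_map_nth[of R "\<phi> i j" "fst (h k)" "snd (h k)" "fst (h l)" "snd (h l)"]
        by (simp add: e_def)
      then show "G (h k) (h l) = (\<Sum>i<n. \<Sum>j<n. cnj (\<zeta> (i, h k)) * F (e k l) i j * \<zeta> (j, h l))"
        unfolding G_def by (intro sum.cong refl) (simp add: F_def)
    qed
    also have "\<dots> \<in> \<real>\<^sub>\<ge>\<^sub>0" by (rule pos)
    finally show "(\<Sum>P\<in>{..<n} \<times> UNIV. \<Sum>Q\<in>{..<n} \<times> UNIV. cnj (\<zeta> P) *
        (case P of (i, p) \<Rightarrow> \<lambda>(j, q). Lambda_map R (\<phi> i j) $ p $ q) Q * \<zeta> Q) \<in> \<real>\<^sub>\<ge>\<^sub>0" .
  qed
qed

lemma Lambda_map_vector_functional: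
  "Lambda_map R (vector_functional R f g) $ (x, a) $ (x', a') = l2_inner f (univ_e R x x' a a' g)"
  by (simp add: Lambda_map_nth vector_functional_def univ_e_in_T)

text \<open>
  A positive matrix over \<open>\<L>\<^sub>X\<close> is a positive kernel with marginals, so the vectors realising it define
  functionals with the right values on the generators.
\<close>

lemma mcone_L_lift:
  fixes R :: "('i, 'x::finite) block_op set"
  assumes inf: "infinite (UNIV :: 'i set)" and R: "bi_isometry_representatives R"
    and u: "u \<in> mcone L_system n"
  shows "\<exists>\<phi>\<in>mcone (dual_system (T_system R)) n. \<forall>i<n. \<forall>j<n. Lambda_map R (\<phi> i j) = u i j"
proof -
  have R': "\<forall>V\<in>R. bi_isometry V" using R unfolding bi_isometry_representatives_def by blast
  define c where "c = (\<lambda>i j. SOME c. marginals (entries (u i j)) c)"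
  have marg: "marginals (entries (u i j)) (c i j)" if "i < n" "j < n" for i j
  proof -
    have "\<exists>c. marginals (entries (u i j)) c" using u that unfolding mcone_L vecs_L by blast
    then show ?thesis unfolding c_def by (rule someI_ex)
  qed
  have "psd_on ({..<n} \<times> UNIV) (\<lambda>(i, p) (j, q). u i j $ p $ q)" using u unfolding mcone_L by blast
  then have psd: "psd_on ({..<n} \<times> UNIV) (\<lambda>(i, x, a) (j, x', a'). entries (u i j) x x' a a')"
    by (simp add: entries_def case_prod_unfold)
  obtain \<eta> where \<eta>: "\<forall>j. \<eta> j \<in> l2 (univ_dom R)"
    and l: "\<forall>i<n. \<forall>j<n. \<forall>x x' a a'. l2_inner (\<eta> i) (univ_e R x x' a a' (\<eta> j)) = entries (u i j) x x' a a'"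
    using universal_realising_kernel[OF inf R marg psd] by blast
  show ?thesis
  proof (intro bexI allI impI)
    show "(\<lambda>i j. vector_functional R (\<eta> i) (\<eta> j)) \<in> mcone (dual_system (T_system R)) n"
      using \<eta> by (intro vector_functional_mcone[OF R']) blast
    fix i j assume "i < n" "j < n"
    then show "Lambda_map R (vector_functional R (\<eta> i) (\<eta> j)) = u i j"
      using l by (simp add: vec_eq_iff split_paired_all Lambda_map_vector_functional entries_def)
  qed
qed

text \<open>
  The block matrix \<open>u\<close> with diagonal \<open>t I\<close> and corners \<open>M\<close> and \<open>M\<^sup>*\<close> is positive for \<open>t\<close> the sum of the moduli
  of the entries of \<open>M\<close>, and its blocks satisfy the marginal conditions with the constants \<open>|X| t\<close>, \<open>c\<close>
  and the conjugate of \<open>c\<close>. Lifting it yields a functional for the corner.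
\<close>

lemma Lambda_map_surj:
  fixes R :: "('i, 'x::finite) block_op set"
  assumes inf: "infinite (UNIV :: 'i set)" and R: "bi_isometry_representatives R"
    and M: "M \<in> vecs L_system"
  shows "\<exists>\<phi>\<in>dual_vecs (T_system R). Lambda_map R \<phi> = M"
proof -
  obtain c where c: "marginals (entries M) c" using M unfolding vecs_L by blast
  define t where "t = complex_of_real (\<Sum>p\<in>UNIV. \<Sum>q\<in>UNIV. cmod (M $ p $ q))"
  define u :: "nat \<Rightarrow> nat \<Rightarrow> complex ^ ('x \<times> 'x) ^ ('x \<times> 'x)" where
    "u = (\<lambda>i j. \<chi> p q. if i = j then (if p = q then t else 0) else if i = 0 then M $ p $ q else cnj (M $ q $ p))"
  have diag: "marginals (entries (u i i)) (of_nat CARD('x) * t)" for i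
    by (auto simp: marginals_def entries_def u_def)
  have corner: "entries (u 0 1) = entries M" by (simp add: entries_def u_def)
  have "marginals (entries (u 1 0)) (cnj c)"
  proof -
    have rows: "(\<Sum>b\<in>UNIV. entries M x x' b b) = (if x = x' then c else 0)"
      and cols: "(\<Sum>y\<in>UNIV. entries M y y a a') = (if a = a' then c else 0)" for x x' a a'
      using c unfolding marginals_def by blast+
    have u10: "entries (u 1 0) x x' a a' = cnj (entries M x' x a' a)" for x x' a a'
      by (simp add: entries_def u_def)
    show ?thesis
      unfolding marginals_def u10 cnj_sum[symmetric] rows cols by auto
  qed
  then have "u i j \<in> vecs L_system" if "i < 2" "j < 2" for i j
    using that diag[of 0] diag[of 1] c corner unfolding vecs_L
    by (auto simp: less_2_cases_iff)
  moreover have "psd_on ({..<2} \<times> UNIV) (\<lambda>(i, p) (j, q). u i j $ p $ q)"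
    using psd_on_corner[of "\<lambda>p q. M $ p $ q"] unfolding u_def t_def by simp
  ultimately have "u \<in> mcone L_system 2" unfolding mcone_L by blast
  then obtain \<phi> where \<phi>: "\<phi> \<in> mcone (dual_system (T_system R)) 2"
    "\<forall>i<2. \<forall>j<2. Lambda_map R (\<phi> i j) = u i j"
    using mcone_L_lift[OF inf R] by blast
  have "u 0 1 = M" by (simp add: u_def vec_eq_iff)
  then show ?thesis using \<phi> by (intro bexI[of _ "\<phi> 0 1"]) (simp_all add: dual_system_def)
qed

theorem proposition3p6:
  fixes R :: "('i, 'x::finite) block_op set"
  assumes "infinite (UNIV :: 'i set)"
    and "bi_isometry_representatives R"
  shows "(\<forall>\<phi> \<in> vecs (dual_system (T_system R)). Lambda_map R \<phi> \<in> vecs L_system) \<and>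
    complete_order_isomorphism (dual_system (T_system R)) L_system (Lambda_map R)"
proof -
  let ?D = "dual_system (T_system R)"
  let ?L = "L_system :: (complex ^ ('x \<times> 'x) ^ ('x \<times> 'x)) matrix_ordered"
  have R: "\<forall>V\<in>R. bi_isometry V" using assms(2) unfolding bi_isometry_representatives_def by blast
  have vD: "vecs ?D = dual_vecs (T_system R)" by (simp add: dual_system_def)
  have into: "Lambda_map R \<phi> \<in> vecs ?L" if "\<phi> \<in> vecs ?D" for \<phi>
    using that unfolding vD by (rule Lambda_map_in_L[OF R])
  have inj: "inj_on (Lambda_map R) (vecs ?D)"
    unfolding vD by (rule inj_onI) (rule Lambda_map_inj)
  have onto: "Lambda_map R ` vecs ?D = vecs ?L"
    using into Lambda_map_surj[OF assms] unfolding vD by blast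
  have closed: "\<phi> + \<psi> \<in> vecs ?D" "c *\<^sub>C \<phi> \<in> vecs ?D" if "\<phi> \<in> vecs ?D" "\<psi> \<in> vecs ?D" for \<phi> \<psi> c
    using that unfolding vD dual_vecs_def clinear_on_def by (auto simp: algebra_simps)
  have add: "Lambda_map R (\<phi> + \<psi>) = Lambda_map R \<phi> + Lambda_map R \<psi>" for \<phi> \<psi>
    by (simp add: vec_eq_iff split_paired_all Lambda_map_nth)
  have scale: "Lambda_map R (c *\<^sub>C \<phi>) = c *\<^sub>C Lambda_map R \<phi>" for c \<phi>
    by (simp add: vec_eq_iff split_paired_all Lambda_map_nth scaleC_vec_def)
  let ?I = "inv_into (vecs ?D) (Lambda_map R)"
  have inv: "?I M \<in> vecs ?D" "Lambda_map R (?I M) = M" if "M \<in> vecs ?L" for M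
    using that onto by (simp_all add: inv_into_into f_inv_into_f)
  have left: "?I (Lambda_map R \<phi>) = \<phi>" if "\<phi> \<in> vecs ?D" for \<phi>
    by (rule inv_into_f_f[OF inj that])
  have "completely_positive ?D ?L (Lambda_map R)"
    unfolding completely_positive_def clinear_on_def
    using into Lambda_map_mcone[OF R] by (auto simp: add scale)
  moreover have "completely_positive ?L ?D ?I"
    unfolding completely_positive_def
  proof (intro conjI allI ballI)
    show "clinear_on (vecs ?L) ?I"
      unfolding clinear_on_def
    proof (intro conjI ballI allI)
      fix M N assume M: "M \<in> vecs ?L" and N: "N \<in> vecs ?L"
      have "?I (Lambda_map R (?I M + ?I N)) = ?I M + ?I N"
        by (rule left[OF closed(1)[OF inv(1)[OF M] inv(1)[OF N]]])
      then show "?I (M + N) = ?I M + ?I N" by (simp only: add inv(2)[OF M] inv(2)[OF N])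
    next
      fix c M assume M: "M \<in> vecs ?L"
      have "?I (Lambda_map R (c *\<^sub>C ?I M)) = c *\<^sub>C ?I M"
        by (rule left[OF closed(2)[OF inv(1)[OF M] inv(1)[OF M]]])
      then show "?I (c *\<^sub>C M) = c *\<^sub>C ?I M" by (simp only: scale inv(2)[OF M])
    qed
    show "?I ` vecs ?L \<subseteq> vecs ?D" using inv(1) by blast
    fix n u assume "u \<in> mcone ?L n"
    then obtain \<phi> where \<phi>: "\<phi> \<in> mcone ?D n" and eq: "\<forall>i<n. \<forall>j<n. Lambda_map R (\<phi> i j) = u i j"
      using mcone_L_lift[OF assms] by blast
    have same: "?I (u i j) = \<phi> i j" if "i < n" "j < n" for i j
    proof -
      have "\<phi> i j \<in> vecs ?D" using \<phi> that by (simp add: dual_system_def)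
      then show ?thesis using left eq that by metis
    qed
    have mcone_D: "w \<in> mcone ?D n \<longleftrightarrow> (\<forall>i<n. \<forall>j<n. w i j \<in> vecs ?D) \<and>
        completely_positive (T_system R) (M_system n) (\<lambda>v i j. if i < n \<and> j < n then w i j v else 0)" for w
      by (simp add: dual_system_def)
    \<comment> \<open>Only the entries with indices below \<open>n\<close> matter for membership in the cone.\<close>
    have "(\<lambda>v i j. if i < n \<and> j < n then ?I (u i j) v else 0) =
        (\<lambda>v i j. if i < n \<and> j < n then \<phi> i j v else 0)"
      by (intro ext) (simp add: same)
    then show "(\<lambda>i j. ?I (u i j)) \<in> mcone ?D n"
      using \<phi> same unfolding mcone_D by simp
  qed
  ultimately have "complete_order_isomorphism ?D ?L (Lambda_map R)"
    unfolding complete_order_isomorphism_def bij_betw_def using inj onto by blast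
  then show ?thesis using into by blast
qed

end
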